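(* Let $G$ be a finite solvable group and let $H$ be a normal subgroup of $G$. Then $\bigcap_{p\in\pi(H)}N_{\mathscr{U}_p}(G,H)=G$ if and only if $N_{\mathscr{U}}(G,H)=G$.
   Context: All groups are finite. $\pi(H)$ is the set of prime divisors of $|H|$ (an empty intersection of subgroups of $G$ is $G$). $\mathscr{U}$ is the class of supersolvable groups; $\mathscr{U}_p$ is the class of $p$-supersolvable groups, i.e. groups each of whose chief factors is either of order $p$ or a $p'$-group. For $\mathscr{F}\in\{\mathscr{U},\mathscr{U}_p\}$ and a group $T$, $T^{\mathscr{F}}$ (the $\mathscr{F}$-residual) is the intersection of all normal subgroups $N$ of $T$ with $T/N\in\mathscr{F}$. For $H\le G$, $N_{\mathscr{F}}(G,H)=\bigcap_{T\le H}N_G(T^{\mathscr{F}})$, the intersection being over all subgroups $T$ of $H$. *)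

theory Defs
  imports
    "HOL-Algebra.Solvable_Groups"
    "HOL-Algebra.Elementary_Groups"
    "HOL-Algebra.Group_Action"
    "HOL-Computational_Algebra.Primes"
begin

text \<open>The subgroups \<open>N\<close> with \<open>supersolvable_seq G N\<close> are those ending a series
  \<open>1 = N\<^sub>0 \<le> N\<^sub>1 \<le> \<dots> \<le> N\<^sub>k = N\<close> with cyclic factors, in which every term is normal in the whole
  group \<open>G\<close> and not only in the next term (contrast \<^const>\<open>solvable_seq\<close>).\<close>

inductive supersolvable_seq :: "('a, 'b) monoid_scheme \<Rightarrow> 'a set \<Rightarrow> bool"
  for G where
    unity: "supersolvable_seq G {\<one>\<^bsub>G\<^esub>}"
  | extension: "\<lbrakk> supersolvable_seq G K; K \<lhd> (G \<lparr> carrier := H \<rparr>); H \<lhd> G;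
                  cyclic_group ((G \<lparr> carrier := H \<rparr>) Mod K) \<rbrakk> \<Longrightarrow> supersolvable_seq G H"

definition supersolvable :: "('a, 'b) monoid_scheme \<Rightarrow> bool"
  where "supersolvable G \<longleftrightarrow> group G \<and> supersolvable_seq G (carrier G)"

definition chief_factor :: "('a, 'b) monoid_scheme \<Rightarrow> 'a set \<Rightarrow> 'a set \<Rightarrow> bool"
  where "chief_factor G H K \<longleftrightarrow>
    H \<lhd> G \<and> K \<lhd> G \<and> K \<subset> H \<and> \<not> (\<exists>L. L \<lhd> G \<and> K \<subset> L \<and> L \<subset> H)"

text \<open>Finiteness is part of the following definition because \<^const>\<open>order\<close> is \<open>0\<close> on infinite
  groups.\<close>

definition p_supersolvable :: "nat \<Rightarrow> ('a, 'b) monoid_scheme \<Rightarrow> bool"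
  where "p_supersolvable p G \<longleftrightarrow> group G \<and> finite (carrier G) \<and>
    (\<forall>H K. chief_factor G H K \<longrightarrow>
       order ((G \<lparr> carrier := H \<rparr>) Mod K) = p \<or> \<not> p dvd order ((G \<lparr> carrier := H \<rparr>) Mod K))"

text \<open>A class of groups enters below only through quotients \<open>T Mod N\<close>, whose elements are cosets;
  hence the type \<open>'a set monoid \<Rightarrow> bool\<close> of the class.  Intersecting with the carrier
  makes an empty intersection the whole group.\<close>

definition residual :: "('a set monoid \<Rightarrow> bool) \<Rightarrow> ('a, 'b) monoid_scheme \<Rightarrow> 'a set"
  where "residual F T = carrier T \<inter> \<Inter>{N. N \<lhd> T \<and> F (T Mod N)}"

definition residual_normalizer ::
    "('a set monoid \<Rightarrow> bool) \<Rightarrow> ('a, 'b) monoid_scheme \<Rightarrow> 'a set \<Rightarrow> 'a set"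
  where "residual_normalizer F G H = carrier G \<inter>
    (\<Inter>T\<in>{T. subgroup T G \<and> T \<subseteq> H}. normalizer G (residual F (G \<lparr> carrier := T \<rparr>)))"

end

theory Submission
  imports
    Defs
    "HOL-Algebra.Sylow"
    "HOL-Algebra.Multiplicative_Group"
    "HOL-Algebra.SndIsomorphismGrp"
begin

text \<open>For a finite solvable group \<open>T\<close> the supersolvable residual and the family of
  \<open>p\<close>-supersolvable residuals determine each other.  Write \<open>X = T\<^sup>U\<close> for the supersolvable
  residual and \<open>O\<^bsup>p'\<^esup>(X)\<close> for the subgroup generated by the elements of \<open>X\<close> of
  \<open>p\<close>-power order, which is the least normal subgroup of \<open>X\<close> whose quotient is a
  \<open>p'\<close>-group.  Then the \<open>p\<close>-supersolvable residual of \<open>T\<close> is \<open>O\<^bsup>p'\<^esup>(X)\<close>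
  (\<open>p_supersolvable_residual\<close>).

  Granting this, both directions are short.  \<open>O\<^bsup>p'\<^esup>(X)\<close> is characteristic in \<open>X\<close>, so it is normal in \<open>G\<close>
  whenever \<open>X\<close> is (\<open>pprime_residual_normal\<close>).  Conversely every element of \<open>X\<close> is a product of elements
  of prime power order, and only primes dividing the order of \<open>H\<close> occur; hence \<open>X\<close> is the join of
  the \<open>O\<^bsup>p'\<^esup>(X)\<close> over these primes, and it is normal in \<open>G\<close> when all of them are
  (\<open>normal_if_pprime_residuals_normal\<close>).

  The identification of the residuals rests on a description of the \<open>p\<close>-supersolvable groups among the
  finite solvable groups \<open>S\<close>: they are those having a normal \<open>p'\<close>-subgroup \<open>M\<close> with \<open>S / M\<close>
  supersolvable.  If \<open>M\<close> exists, a chief factor of \<open>S\<close> is a quotient of a section of the series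
  \<open>1 \<le> M \<le> \<dots> \<le> S\<close>, hence a \<open>p'\<close>-group or cyclic (\<open>p_supersolvableI\<close>).  For the converse
  (\<open>p_supersolvable_imp_series\<close>) divide by the largest normal \<open>p'\<close>-subgroup.  A minimal normal subgroup
  \<open>L\<close> then has order \<open>p\<close>, and by induction some normal \<open>M \<ge> L\<close> has \<open>M / L\<close> a \<open>p'\<close>-group and \<open>S / M\<close>
  supersolvable.  Here \<open>L\<close> is its own centralizer in \<open>M\<close>; since \<open>Aut L\<close> is abelian, \<open>S\<close> centralizes
  \<open>M / L\<close>, and so \<open>S\<close> is supersolvable.

  Quotients change the type of a group, which an induction hypothesis cannot follow.  So sections
  \<open>M / R\<close> are described by conditions on elements of the ambient group, and these
  are carried along quotient maps when a statement about a quotient group is needed.\<close>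

section \<open>Elements, powers and cosets\<close>

lemma (in group) inv_cancel_left:
  assumes "x \<in> carrier G" "y \<in> carrier G"
  shows "inv x \<otimes> (x \<otimes> y) = y" "x \<otimes> (inv x \<otimes> y) = y"
  using assms by (simp_all flip: m_assoc)

lemma (in group) subgroup_nat_pow_closed:
  assumes "subgroup K G" "x \<in> K"
  shows "x [^] (n::nat) \<in> K"
  using subgroup_int_pow_closed[OF assms, of "int n"] by (simp add: int_pow_int)

lemma (in group) conj_nat_pow:
  assumes "x \<in> carrier G" "g \<in> carrier G"
  shows "(g \<otimes> x \<otimes> inv g) [^] (n::nat) = g \<otimes> x [^] n \<otimes> inv g"
  using assms by (induction n) (simp_all add: m_assoc inv_cancel_left)

lemma (in group) mem_if_coprime_powers_mem:
  assumes "x \<in> carrier G" "x [^] (m::nat) \<in> R" "x [^] (n::nat) \<in> R" "coprime m n" "subgroup R G"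
  shows "x \<in> R"
proof -
  obtain u v where "u * int m + v * int n = 1" using assms(4) bezout_int[of "int m" "int n"] by auto
  then have "x = x [^] (int m * u + int n * v)" using assms(1) by (simp add: mult.commute int_pow_1)
  also have "\<dots> = (x [^] m) [^] u \<otimes> (x [^] n) [^] v"
    using assms(1) by (simp add: int_pow_mult int_pow_pow flip: int_pow_int)
  finally show ?thesis
    using assms subgroup_int_pow_closed subgroup.m_closed by metis
qed

text \<open>If \<open>z\<close> commutes with \<open>x\<close>, moving \<open>y\<close> past each factor of \<open>x [^] n\<close> costs one factor \<open>z\<close>.  This is
  the rule \<open>[x [^] n, y] = [x, y] [^] n\<close> for a commutator \<open>z = [x, y]\<close> that is central enough.\<close>

lemma (in group) pow_commute_factor:
  assumes "x \<in> carrier G" "y \<in> carrier G" "z \<in> carrier G"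
    and "x \<otimes> y = z \<otimes> (y \<otimes> x)" "x \<otimes> z = z \<otimes> x"
  shows "x [^] (n::nat) \<otimes> y = z [^] n \<otimes> (y \<otimes> x [^] n)"
proof (induction n)
  case (Suc n)
  have xz: "x [^] n \<otimes> z = z \<otimes> x [^] n"
    using pow_mult_distrib assms(1,3,5) by (induction n) (simp_all add: m_assoc, metis m_assoc nat_pow_closed)
  have "x [^] Suc n \<otimes> y = x [^] n \<otimes> (x \<otimes> y)" using assms by (simp add: m_assoc)
  also have "\<dots> = (x [^] n \<otimes> z) \<otimes> (y \<otimes> x)" using assms(1-3) by (simp add: assms(4) m_assoc)
  also have "\<dots> = z \<otimes> (x [^] n \<otimes> y) \<otimes> x" using assms(1-3) by (simp add: xz m_assoc)
  also have "\<dots> = (z \<otimes> z [^] n) \<otimes> (y \<otimes> (x [^] n \<otimes> x))"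
    using assms(1-3) by (simp add: Suc m_assoc)
  also have "\<dots> = z [^] Suc n \<otimes> (y \<otimes> x [^] Suc n)"
    by (simp only: nat_pow_Suc2[OF assms(3)] nat_pow_Suc[of x n])
  finally show ?case .
qed (use assms in simp)

text \<open>Cauchy's theorem: the Sylow existence theorem, used with exponent 1, gives a subgroup of order
  \<open>p\<close>.\<close>

lemma (in group) exists_element_of_prime_order:
  assumes "finite (carrier G)" "prime p" "p dvd order G"
  obtains x where "x \<in> carrier G" "x \<noteq> \<one>" "x [^] p = \<one>"
proof -
  obtain m where "order G = p ^ 1 * m" using assms by auto
  then obtain P where P: "subgroup P G" "card P = p"
    using sylow_thm[OF assms(2) is_group _ assms(1)] by (metis power_one_right)
  have "P \<noteq> {\<one>}" using P assms(2) by auto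
  then obtain x where x: "x \<in> P" "x \<noteq> \<one>" using subgroup.one_closed[OF P(1)] by auto
  have "x [^]\<^bsub>G\<lparr>carrier := P\<rparr>\<^esub> order (G\<lparr>carrier := P\<rparr>) = \<one>\<^bsub>G\<lparr>carrier := P\<rparr>\<^esub>"
    using x by (intro group.pow_order_eq_1 subgroup_imp_group P) auto
  then have "x [^] p = \<one>" using P by (simp add: order_def flip: nat_pow_consistent)
  with x P show ?thesis using that subgroup.mem_carrier by metis
qed

lemma (in group) cyclic_group_order_eq_ord:
  assumes "cyclic_group G"
  obtains g where "g \<in> carrier G" "order G = ord g"
proof -
  obtain g where g: "g \<in> carrier G" "carrier G = range (\<lambda>n::int. g [^] n)" using assms cyclic_group by blast
  then have "carrier G = generate G {g}" using generate_pow by auto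
  then show ?thesis using that g(1) generate_pow_card[OF g(1)] by (simp add: order_def)
qed

lemma (in group) prime_order_cyclic:
  assumes "prime (order G)"
  shows "cyclic_group G"
proof -
  have fin: "finite (carrier G)" using order_gt_0_iff_finite prime_gt_0_nat[OF assms] by simp
  have "carrier G \<noteq> {\<one>}" using assms order_one_triv_iff by auto
  then obtain g where g: "g \<in> carrier G" "g \<noteq> \<one>" using one_closed by blast
  have "ord g = order G"
    using g assms ord_dvd_group_order[OF g(1)] ord_eq_1[OF g(1)] by (metis prime_nat_iff)
  then have "card (generate G {g}) = card (carrier G)" using generate_pow_card[OF g(1)] by (simp add: order_def)
  then have "generate G {g} = carrier G" using fin generate_incl[of "{g}"] g(1) by (intro card_subset_eq) auto
  then have "carrier G = range (\<lambda>k::int. g [^] k)" unfolding generate_pow[OF g(1)] by auto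
  then show ?thesis using g(1) unfolding cyclic_group by blast
qed

lemma (in normal) rcos_eq_iff:
  assumes "x \<in> carrier G" "y \<in> carrier G"
  shows "H #> x = H #> y \<longleftrightarrow> x \<otimes> inv y \<in> H"
  using assms by (metis is_group rcos_module rcos_self repr_independence subgroup_axioms)

lemma (in normal) rcos_eq_one_iff:
  assumes "x \<in> carrier G"
  shows "H #> x = H \<longleftrightarrow> x \<in> H"
  using assms coset_join1 coset_join2 subgroup_axioms by blast

lemma (in normal) rcos_image_self: "(\<lambda>x. H #> x) ` H = {\<one>\<^bsub>G Mod H\<^esub>}"
  using rcos_const[OF is_group] one_closed by (simp add: image_constant[of \<one>])

lemma (in normal) rcos_vimage_one: "{x \<in> carrier G. H #> x \<in> {\<one>\<^bsub>G Mod H\<^esub>}} = H"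
  using rcos_eq_one_iff subset by auto

lemma (in normal) rcos_vimage_image:
  assumes "subgroup L G" "H \<subseteq> L"
  shows "{x \<in> carrier G. H #> x \<in> (\<lambda>x. H #> x) ` L} = L"
proof -
  have "x \<in> L" if x: "x \<in> carrier G" and l: "l \<in> L" "H #> x = H #> l" for x l
  proof -
    have lG: "l \<in> carrier G" using assms(1) l subgroup.mem_carrier by metis
    have "x \<otimes> inv l \<in> L" using rcos_eq_iff[OF x lG] l(2) assms(2) by blast
    then have "x \<otimes> inv l \<otimes> l \<in> L" using assms(1) l(1) subgroup.m_closed by metis
    then show ?thesis using x lG by (simp add: m_assoc)
  qed
  then show ?thesis using subgroup.mem_carrier[OF assms(1)] by blast
qed

lemma (in normal) group_hom_FactGroup: "group_hom G (G Mod H) (\<lambda>x. H #> x)"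
  using factorgroup_is_group r_coset_hom_Mod is_group
  by (simp add: group_hom_def group_hom_axioms_def)

lemma (in group_hom) normal_vimage:
  assumes "M \<lhd> H"
  shows "{x \<in> carrier G. h x \<in> M} \<lhd> G"
proof -
  interpret M: normal M H by fact
  show ?thesis
  proof (rule G.normal_invI)
    show "subgroup {x \<in> carrier G. h x \<in> M} G"
      by (rule G.subgroupI) (auto intro!: exI[of _ "\<one>\<^bsub>G\<^esub>"])
  qed (auto intro: M.inv_op_closed2)
qed

lemma (in group) normal_set_mult:
  assumes "A \<lhd> G" "B \<lhd> G"
  shows "A <#> B \<lhd> G"
proof -
  interpret A: normal A G by fact
  interpret B: normal B G by fact
  show ?thesis
  proof (rule normal_invI)
    show "subgroup (A <#> B) G"
      using second_isomorphism_grp.normal_set_mult_subgroup[of A G B] assms(1) B.subgroup_axioms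
      by (simp add: second_isomorphism_grp_def second_isomorphism_grp_axioms_def)
    show "g \<otimes> x \<otimes> inv g \<in> A <#> B" if "x \<in> A <#> B" "g \<in> carrier G" for x g
    proof -
      obtain a b where ab: "a \<in> A" "b \<in> B" "x = a \<otimes> b" using \<open>x \<in> _\<close> by (auto simp: set_mult_def)
      have "g \<otimes> x \<otimes> inv g = (g \<otimes> a \<otimes> inv g) \<otimes> (g \<otimes> b \<otimes> inv g)"
        using ab \<open>g \<in> _\<close> by (simp add: m_assoc inv_cancel_left A.mem_carrier B.mem_carrier)
      with ab \<open>g \<in> _\<close> show ?thesis
        using A.inv_op_closed2[of g a] B.inv_op_closed2[of g b] unfolding set_mult_def by blast
    qed
  qed
qed

section \<open>Coprime sections and cyclic sections\<close>

text \<open>For \<open>R\<close> normal in \<open>M\<close>, both finite, and \<open>p\<close> prime, this says that \<open>M / R\<close> is a \<open>p'\<close>-group.\<close>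

definition coprime_mod :: "('a, 'b) monoid_scheme \<Rightarrow> nat \<Rightarrow> 'a set \<Rightarrow> 'a set \<Rightarrow> bool"
  where "coprime_mod G p M R \<longleftrightarrow> (\<forall>x\<in>M. \<exists>n::nat. coprime n p \<and> x [^]\<^bsub>G\<^esub> n \<in> R)"

text \<open>For \<open>R\<close> normal in \<open>M\<close> this says that \<open>M / R\<close> is cyclic.  Multiplying by the power, instead of
  equating cosets, is harmless because \<open>i\<close> ranges over the integers.\<close>

definition cyclic_mod :: "('a, 'b) monoid_scheme \<Rightarrow> 'a set \<Rightarrow> 'a set \<Rightarrow> bool"
  where "cyclic_mod G M R \<longleftrightarrow> (\<exists>h\<in>M. \<forall>x\<in>M. \<exists>i::int. x \<otimes>\<^bsub>G\<^esub> h [^]\<^bsub>G\<^esub> i \<in> R)"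

lemma coprime_mod_trans:
  assumes "group G" "M \<subseteq> carrier G" "coprime_mod G p M L" "coprime_mod G p L R"
  shows "coprime_mod G p M R"
  unfolding coprime_mod_def
proof
  interpret group G by fact
  fix x assume x: "x \<in> M"
  obtain n where n: "coprime n p" "x [^]\<^bsub>G\<^esub> (n::nat) \<in> L" using x assms(3) by (auto simp: coprime_mod_def)
  obtain m where m: "coprime m p" "(x [^]\<^bsub>G\<^esub> n) [^]\<^bsub>G\<^esub> (m::nat) \<in> R" using n assms(4) by (auto simp: coprime_mod_def)
  have "x [^]\<^bsub>G\<^esub> (n * m) \<in> R" using m x assms(2) by (simp add: nat_pow_pow subset_iff)
  with n m show "\<exists>n::nat. coprime n p \<and> x [^]\<^bsub>G\<^esub> n \<in> R"
    using coprime_mult_left_iff by blast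
qed

lemma (in normal) coprime_mod_iff_coset_powers:
  assumes "M \<subseteq> carrier G"
  shows "coprime_mod G p M H \<longleftrightarrow> (\<forall>x\<in>M. \<exists>n::nat. coprime n p \<and> (H #> x) [^]\<^bsub>G Mod H\<^esub> n = H)"
  using assms by (simp add: coprime_mod_def FactGroup_pow rcos_eq_one_iff subset_iff)

lemma (in normal) cyclic_mod_iff_coset_powers:
  assumes "M \<subseteq> carrier G"
  shows "cyclic_mod G M H \<longleftrightarrow> (\<exists>h\<in>M. \<forall>x\<in>M. \<exists>i::int. H #> x = (H #> h) [^]\<^bsub>G Mod H\<^esub> i)"
proof -
  have key: "H #> x = (H #> h) [^]\<^bsub>G Mod H\<^esub> (i::int) \<longleftrightarrow> x \<otimes> h [^] (-i) \<in> H"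
    if "x \<in> M" "h \<in> M" for x h i
    using that assms by (simp add: FactGroup_int_pow rcos_eq_iff int_pow_neg subset_iff)
  have "cyclic_mod G M H \<longleftrightarrow> (\<exists>h\<in>M. \<forall>x\<in>M. \<exists>i::int. x \<otimes> h [^] (-i) \<in> H)"
    unfolding cyclic_mod_def by (metis minus_minus)
  then show ?thesis using key by simp
qed

lemma (in normal) coprime_order_FactGroup_iff:
  assumes "finite (carrier G)" "prime p"
  shows "\<not> p dvd order (G Mod H) \<longleftrightarrow> coprime_mod G p (carrier G) H"
proof
  interpret F: group "G Mod H" by (rule factorgroup_is_group)
  have fin: "finite (carrier (G Mod H))" using assms by (simp add: carrier_FactGroup)
  show "coprime_mod G p (carrier G) H" if "\<not> p dvd order (G Mod H)"
    unfolding coprime_mod_def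
  proof
    fix x assume x: "x \<in> carrier G"
    then have "(H #> x) [^]\<^bsub>G Mod H\<^esub> order (G Mod H) = H"
      using F.pow_order_eq_1[of "H #> x"] fin by (simp add: carrier_FactGroup)
    then have "x [^] order (G Mod H) \<in> H" using x by (simp add: FactGroup_pow rcos_eq_one_iff)
    moreover have "coprime (order (G Mod H)) p"
      using that assms(2) by (metis coprime_commute prime_imp_coprime)
    ultimately show "\<exists>n. coprime n p \<and> x [^] (n::nat) \<in> H" by blast
  qed
  show "\<not> p dvd order (G Mod H)" if cop: "coprime_mod G p (carrier G) H"
  proof
    assume "p dvd order (G Mod H)"
    then obtain X where X: "X \<in> carrier (G Mod H)" "X \<noteq> H" "X [^]\<^bsub>G Mod H\<^esub> p = H"
      using F.exists_element_of_prime_order fin assms(2) by auto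
    then obtain x where x: "x \<in> carrier G" "X = H #> x" by (auto simp: carrier_FactGroup)
    obtain n where n: "coprime n p" "x [^] (n::nat) \<in> H" using cop x(1) unfolding coprime_mod_def by blast
    have "x [^] p \<in> H" using X x by (simp add: FactGroup_pow rcos_eq_one_iff)
    then have "x \<in> H" using mem_if_coprime_powers_mem n x subgroup_axioms by blast
    then show False using X x by (simp add: rcos_eq_one_iff)
  qed
qed

lemma (in group) coprime_order_quotient_iff:
  assumes "subgroup H G" "K \<lhd> G\<lparr>carrier := H\<rparr>" "finite (carrier G)" "prime p"
  shows "\<not> p dvd order (G\<lparr>carrier := H\<rparr> Mod K) \<longleftrightarrow> coprime_mod G p H K"
proof -
  have "finite (carrier (G\<lparr>carrier := H\<rparr>))" using finite_subset[OF subgroup.subset[OF assms(1)] assms(3)] by simp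
  then show ?thesis
    using normal.coprime_order_FactGroup_iff[OF assms(2) _ assms(4)]
    by (simp add: coprime_mod_def flip: nat_pow_consistent)
qed

lemma (in normal) cyclic_FactGroup_iff:
  "cyclic_group (G Mod H) \<longleftrightarrow> cyclic_mod G (carrier G) H"
proof -
  interpret F: group "G Mod H" by (rule factorgroup_is_group)
  have sub: "range (\<lambda>i::int. X [^]\<^bsub>G Mod H\<^esub> i) \<subseteq> carrier (G Mod H)" if "X \<in> carrier (G Mod H)" for X
    using that by auto
  have "cyclic_group (G Mod H) \<longleftrightarrow>
      (\<exists>h\<in>carrier G. \<forall>x\<in>carrier G. H #> x \<in> range (\<lambda>i::int. (H #> h) [^]\<^bsub>G Mod H\<^esub> i))"
    using sub unfolding F.cyclic_group carrier_FactGroup by (simp add: set_eq_subset image_subset_iff)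
  also have "\<dots> \<longleftrightarrow> cyclic_mod G (carrier G) H"
    unfolding cyclic_mod_iff_coset_powers[OF subset_refl] by (simp add: image_iff)
  finally show ?thesis .
qed

lemma (in group) cyclic_quotient_iff:
  assumes "subgroup H G" "K \<lhd> G\<lparr>carrier := H\<rparr>"
  shows "cyclic_group (G\<lparr>carrier := H\<rparr> Mod K) \<longleftrightarrow> cyclic_mod G H K"
proof -
  have "(\<exists>h\<in>H. \<forall>x\<in>H. \<exists>i::int. x \<otimes> h [^]\<^bsub>G\<lparr>carrier := H\<rparr>\<^esub> i \<in> K) \<longleftrightarrow> (\<exists>h\<in>H. \<forall>x\<in>H. \<exists>i::int. x \<otimes> h [^] i \<in> K)"
    by (intro bex_cong ball_cong refl) (simp flip: int_pow_consistent[OF assms(1)])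
  then show ?thesis
    using normal.cyclic_FactGroup_iff[OF assms(2)] by (simp add: cyclic_mod_def)
qed

lemma (in group_hom) coprime_mod_image:
  assumes "M \<subseteq> carrier G" "coprime_mod G p M R"
  shows "coprime_mod H p (h ` M) (h ` R)"
  unfolding coprime_mod_def
proof safe
  fix x assume "x \<in> M"
  then obtain n where "coprime n p" "x [^] (n::nat) \<in> R" using assms(2) by (auto simp: coprime_mod_def)
  then show "\<exists>n. coprime n p \<and> h x [^]\<^bsub>H\<^esub> (n::nat) \<in> h ` R"
    using assms(1) \<open>x \<in> M\<close> by (metis hom_nat_pow imageI subset_iff)
qed

lemma (in group_hom) coprime_mod_vimage:
  assumes "coprime_mod H p M R"
  shows "coprime_mod G p {x \<in> carrier G. h x \<in> M} {x \<in> carrier G. h x \<in> R}"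
  using assms by (fastforce simp: coprime_mod_def hom_nat_pow)

lemma (in group_hom) cyclic_mod_image:
  assumes "M \<subseteq> carrier G" "cyclic_mod G M R"
  shows "cyclic_mod H (h ` M) (h ` R)"
proof -
  obtain a where a: "a \<in> M" "\<And>x. x \<in> M \<Longrightarrow> \<exists>i::int. x \<otimes> a [^] i \<in> R"
    using assms(2) by (auto simp: cyclic_mod_def)
  have "\<exists>i::int. h x \<otimes>\<^bsub>H\<^esub> h a [^]\<^bsub>H\<^esub> i \<in> h ` R" if x: "x \<in> M" for x
  proof -
    obtain i where i: "x \<otimes> a [^] (i::int) \<in> R" using a x by blast
    have "h (x \<otimes> a [^] i) = h x \<otimes>\<^bsub>H\<^esub> h a [^]\<^bsub>H\<^esub> i"
      using a x assms(1) by (simp add: subset_iff hom_int_pow)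
    with i show ?thesis by (metis imageI)
  qed
  then show ?thesis using a by (auto simp: cyclic_mod_def)
qed

lemma (in group_hom) cyclic_mod_vimage:
  assumes surj: "h ` carrier G = carrier H" and M: "M \<subseteq> carrier H" and cyc: "cyclic_mod H M R"
  shows "cyclic_mod G {x \<in> carrier G. h x \<in> M} {x \<in> carrier G. h x \<in> R}"
proof -
  obtain b where b: "b \<in> M" "\<And>y. y \<in> M \<Longrightarrow> \<exists>i::int. y \<otimes>\<^bsub>H\<^esub> b [^]\<^bsub>H\<^esub> i \<in> R"
    using cyc by (auto simp: cyclic_mod_def)
  obtain a where a: "a \<in> carrier G" "b = h a" using b M surj by blast
  have "\<exists>i::int. x \<otimes> a [^] i \<in> {x \<in> carrier G. h x \<in> R}" if "x \<in> carrier G" "h x \<in> M" for x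
    using b(2)[OF that(2)] that a by (auto simp: hom_int_pow)
  then show ?thesis using a b by (auto simp: cyclic_mod_def)
qed

text \<open>The section \<open>(H \<inter> S) / (K \<inter> S)\<close> embeds in the cyclic section \<open>H / K\<close>, and subgroups of cyclic groups
  are cyclic: a generator comes from the least positive power of a generator \<open>h\<close> of \<open>H / K\<close> that
  is represented by an element of \<open>H \<inter> S\<close>.\<close>

lemma (in group) cyclic_mod_Int:
  assumes "finite (carrier G)" "K \<lhd> G" "subgroup H G" "subgroup S G" "cyclic_mod G H K"
  shows "cyclic_mod G (H \<inter> S) (K \<inter> S)"
proof -
  interpret K: normal K G by fact
  interpret F: group "G Mod K" by (rule K.factorgroup_is_group)
  interpret \<pi>: group_hom G "G Mod K" "\<lambda>x. K #> x" by (rule K.group_hom_FactGroup)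
  have HS: "subgroup (H \<inter> S) G" using assms subgroups_Inter_pair by blast
  have HG: "H \<subseteq> carrier G" using assms subgroup.subset by blast
  obtain h where h: "h \<in> H" "\<And>x. x \<in> H \<Longrightarrow> \<exists>i::int. K #> x = (K #> h) [^]\<^bsub>G Mod K\<^esub> i"
    using assms(5) K.cyclic_mod_iff_coset_powers[OF HG] by blast
  have hG: "h \<in> carrier G" using h HG by blast
  \<comment> \<open>The positive exponents whose power of \<open>h\<close> is represented by an element of \<open>H \<inter> S\<close>.\<close>
  define J where "J d \<longleftrightarrow> 0 < d \<and> (\<exists>s\<in>H \<inter> S. K #> s = (K #> h) [^]\<^bsub>G Mod K\<^esub> int d)" for d
  have "J (order G)"
    unfolding J_def
  proof (intro conjI bexI[of _ \<one>])
    show "0 < order G" using assms(1) order_gt_0_iff_finite by simp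
    show "K #> \<one> = (K #> h) [^]\<^bsub>G Mod K\<^esub> int (order G)"
      using hG pow_order_eq_1[of h] by (simp add: K.FactGroup_pow int_pow_int)
    show "\<one> \<in> H \<inter> S" using HS subgroup.one_closed by blast
  qed
  then have J: "J (LEAST d. J d)" "\<And>e. J e \<Longrightarrow> (LEAST d. J d) \<le> e" by (auto intro: LeastI Least_le)
  define d where "d = (LEAST d. J d)"
  obtain s where s: "s \<in> H \<inter> S" "K #> s = (K #> h) [^]\<^bsub>G Mod K\<^esub> int d" and d0: "d > 0"
    using J(1) unfolding J_def d_def by blast
  have sG: "s \<in> carrier G" using s HG by blast
  have hF: "K #> h \<in> carrier (G Mod K)" using hG by simp
  have "\<exists>i::int. x \<otimes> s [^] i \<in> K \<inter> S" if x: "x \<in> H \<inter> S" for x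
  proof -
    have xG: "x \<in> carrier G" using x HG by blast
    obtain j where j: "K #> x = (K #> h) [^]\<^bsub>G Mod K\<^esub> (j::int)" using x h by blast
    \<comment> \<open>Division with remainder by \<open>d\<close>: the coset of \<open>y\<close> is the power of \<open>h\<close> with exponent \<open>j mod d\<close>.\<close>
    define y where "y = x \<otimes> s [^] (- (j div int d))"
    have y: "y \<in> H \<inter> S"
      unfolding y_def using x s HS by (meson subgroup.m_closed subgroup_int_pow_closed)
    have "K #> y = (K #> x) \<otimes>\<^bsub>G Mod K\<^esub> (K #> s) [^]\<^bsub>G Mod K\<^esub> (- (j div int d))"
      unfolding y_def using xG sG \<pi>.hom_mult[of x "s [^] (- (j div int d))"] \<pi>.hom_int_pow[of s] by simp
    also have "\<dots> = (K #> h) [^]\<^bsub>G Mod K\<^esub> (j + int d * (- (j div int d)))"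
      using hF j s(2) by (simp only: F.int_pow_mult F.int_pow_pow)
    also have "j + int d * (- (j div int d)) = int (nat (j mod int d))"
      using d0 by (simp add: minus_mult_div_eq_mod)
    finally have yr: "K #> y = (K #> h) [^]\<^bsub>G Mod K\<^esub> int (nat (j mod int d))" .
    have "nat (j mod int d) < d" using d0 by (simp add: nat_less_iff)
    then have "\<not> J (nat (j mod int d))" using J(2) unfolding d_def by fastforce
    then have "nat (j mod int d) = 0" using y yr unfolding J_def by (metis gr0I)
    then have "K #> y = K" using yr by simp
    moreover have "y \<in> carrier G" using y HG by blast
    ultimately have "y \<in> K" using K.rcos_eq_one_iff by simp
    then show ?thesis using y unfolding y_def by blast
  qed
  then show ?thesis using s unfolding cyclic_mod_def by blast
qed

section \<open>Normal series with cyclic factors\<close>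

text \<open>A series from \<open>R\<close> upwards plays the role of \<open>supersolvable_seq\<close> for the quotient by \<open>R\<close> without leaving
  the group.\<close>

inductive cyclic_series :: "('a, 'b) monoid_scheme \<Rightarrow> 'a set \<Rightarrow> 'a set \<Rightarrow> bool"
  for G R where
    base: "cyclic_series G R R"
  | step: "\<lbrakk>cyclic_series G R K; K \<subseteq> H; H \<lhd> G; cyclic_mod G H K\<rbrakk> \<Longrightarrow> cyclic_series G R H"

lemma cyclic_series_trans:
  assumes "cyclic_series G B C" "cyclic_series G A B"
  shows "cyclic_series G A C"
  using assms by induction (auto intro: cyclic_series.step)

lemma cyclic_series_normal: "cyclic_series G R H \<Longrightarrow> R \<lhd> G \<Longrightarrow> H \<lhd> G"
  by (induction rule: cyclic_series.induct) auto

lemma (in group_hom) cyclic_series_image: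
  assumes surj: "h ` carrier G = carrier H" and "cyclic_series G R M" "R \<lhd> G"
  shows "cyclic_series H (h ` R) (h ` M)"
  using assms(2)
proof induction
  case base show ?case by (rule cyclic_series.base)
next
  case (step A B)
  show ?case
  proof (rule cyclic_series.step[OF step(5)])
    show "h ` B \<lhd> H" using normal.surj_hom_normal_subgroup[OF step(3) group_hom_axioms surj] .
    show "cyclic_mod H (h ` B) (h ` A)"
      using cyclic_mod_image step(4) subgroup.subset[OF normal_imp_subgroup[OF step(3)]] by blast
  qed (use step(2) in blast)
qed

lemma (in group_hom) cyclic_series_vimage:
  assumes surj: "h ` carrier G = carrier H" and "cyclic_series H R M" "R \<lhd> H"
  shows "cyclic_series G {x \<in> carrier G. h x \<in> R} {x \<in> carrier G. h x \<in> M}"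
  using assms(2)
proof induction
  case base show ?case by (rule cyclic_series.base)
next
  case (step A B)
  show ?case
  proof (rule cyclic_series.step[OF step(5)])
    show "{x \<in> carrier G. h x \<in> B} \<lhd> G" using normal_vimage[OF step(3)] .
    show "cyclic_mod G {x \<in> carrier G. h x \<in> B} {x \<in> carrier G. h x \<in> A}"
      using cyclic_mod_vimage[OF surj] step(4) subgroup.subset[OF normal_imp_subgroup[OF step(3)]] by blast
  qed (use step(2) in blast)
qed

text \<open>Together with transitivity this shows that groups with supersolvable quotients by \<open>R\<close> and \<open>S\<close>
  have a supersolvable quotient by \<open>R \<inter> S\<close>: a series from \<open>R\<close> to the top is cut down to one from
  \<open>R \<inter> S\<close> to \<open>S\<close>.\<close>

lemma (in group) cyclic_series_Int:
  assumes "finite (carrier G)" "R \<lhd> G" "S \<lhd> G" "cyclic_series G R H"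
  shows "cyclic_series G (R \<inter> S) (H \<inter> S)"
  using assms(4)
proof induction
  case base show ?case by (rule cyclic_series.base)
next
  case (step A B)
  have A: "A \<lhd> G" using cyclic_series_normal step(1) assms(2) by blast
  show ?case
  proof (rule cyclic_series.step[OF step(5)])
    show "B \<inter> S \<lhd> G" using normal_subgroup_intersect step(3) assms(3) by blast
    show "cyclic_mod G (B \<inter> S) (A \<inter> S)"
      using cyclic_mod_Int[OF assms(1) A] step normal_imp_subgroup assms(3) by blast
  qed (use step(2) in blast)
qed

lemma (in group) supersolvable_iff_cyclic_series:
  "supersolvable G \<longleftrightarrow> cyclic_series G {\<one>} (carrier G)"
proof -
  have "cyclic_series G {\<one>} H" if "supersolvable_seq G H" for H
    using that
  proof induction
    case unity show ?case by (rule cyclic_series.base)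
  next
    case (extension K H)
    have "K \<subseteq> H" using subgroup.subset[OF normal_imp_subgroup[OF extension(2)]] by simp
    with extension show ?case
      using cyclic_quotient_iff[OF normal_imp_subgroup[OF extension(3)] extension(2)]
      by (blast intro: cyclic_series.step)
  qed
  moreover have "supersolvable_seq G H" if "cyclic_series G {\<one>} H" for H
    using that
  proof induction
    case base show ?case by (rule supersolvable_seq.unity)
  next
    case (step K H)
    have "K \<lhd> G" using cyclic_series_normal step(1) one_is_normal by blast
    then have "K \<lhd> G\<lparr>carrier := H\<rparr>"
      using normal_restrict_supergroup step normal_imp_subgroup by blast
    then show ?case
      using step cyclic_quotient_iff[OF normal_imp_subgroup[OF step(3)]]
      by (blast intro: supersolvable_seq.extension)
  qed
  ultimately show ?thesis using is_group by (auto simp: supersolvable_def)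
qed

lemma (in normal) supersolvable_FactGroup_iff:
  "supersolvable (G Mod H) \<longleftrightarrow> cyclic_series G H (carrier G)"
proof -
  interpret F: group "G Mod H" by (rule factorgroup_is_group)
  interpret \<pi>: group_hom G "G Mod H" "\<lambda>x. H #> x" by (rule group_hom_FactGroup)
  have surj: "(\<lambda>x. H #> x) ` carrier G = carrier (G Mod H)" by (simp add: carrier_FactGroup)
  have "{x \<in> carrier G. H #> x \<in> carrier (G Mod H)} = carrier G" using surj by auto
  then show ?thesis
    using rcos_image_self rcos_vimage_one \<pi>.cyclic_series_image[OF surj, of H "carrier G"] normal_axioms surj
      \<pi>.cyclic_series_vimage[OF surj, of "{\<one>\<^bsub>G Mod H\<^esub>}" "carrier (G Mod H)"] F.one_is_normal
    unfolding F.supersolvable_iff_cyclic_series by metis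
qed

section \<open>Chief factors of an extension of a coprime group by a supersolvable group\<close>

text \<open>\<open>K (H \<inter> B)\<close> is a normal subgroup between \<open>K\<close> and \<open>H\<close>, so it is one of the two.  In the second case
  \<open>H / K\<close> is a quotient of \<open>H \<inter> B\<close>.\<close>

lemma (in group) chief_factor_Int_cases:
  assumes "chief_factor G H K" "B \<lhd> G"
  shows "H \<inter> B \<subseteq> K \<or> (\<forall>x\<in>H. \<exists>b\<in>H \<inter> B. K #> x = K #> b)"
proof -
  have HK: "H \<lhd> G" "K \<lhd> G" "K \<subset> H" using assms by (auto simp: chief_factor_def)
  interpret H: normal H G by fact
  interpret K: normal K G by fact
  interpret B: normal B G by fact
  define L where "L = K <#> (H \<inter> B)"
  have LG: "L \<lhd> G" unfolding L_def using HK assms normal_set_mult normal_subgroup_intersect by blast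
  have KL: "K \<subseteq> L" and BL: "H \<inter> B \<subseteq> L"
    unfolding L_def set_mult_def by (force intro: bexI[of _ \<one>])+
  have LH: "L \<subseteq> H" unfolding L_def set_mult_def using HK by auto
  consider "L = K" | "L = H" using assms(1) LG KL LH by (auto simp: chief_factor_def)
  then show ?thesis
  proof cases
    case 2
    have "\<exists>b\<in>H \<inter> B. K #> x = K #> b" if x: "x \<in> H" for x
    proof -
      obtain k b where kb: "k \<in> K" "b \<in> H \<inter> B" "x = k \<otimes> b" using x 2 unfolding L_def set_mult_def by blast
      then have "x \<otimes> inv b = k" by (simp add: m_assoc)
      with kb show ?thesis using K.rcos_eq_iff by (metis H.mem_carrier IntD1 x)
    qed
    then show ?thesis by blast
  qed (use BL in blast)
qed

text \<open>If \<open>p\<close> divides the order of the cyclic group \<open>H / K\<close>, the elements killed by \<open>p\<close> form a nontrivial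
  characteristic subgroup.  By minimality it is everything, so \<open>H / K\<close> is cyclic of exponent \<open>p\<close>.\<close>

lemma (in group) cyclic_chief_factor_order:
  assumes "finite (carrier G)" "prime p" "chief_factor G H K" "cyclic_mod G H K"
  shows "order (G\<lparr>carrier := H\<rparr> Mod K) = p \<or> \<not> p dvd order (G\<lparr>carrier := H\<rparr> Mod K)"
proof (cases "p dvd order (G\<lparr>carrier := H\<rparr> Mod K)")
  case True
  let ?A = "G\<lparr>carrier := H\<rparr>"
  have HK: "H \<lhd> G" "K \<lhd> G" "K \<subset> H" using assms by (auto simp: chief_factor_def)
  interpret H: normal H G by fact
  interpret KG: normal K G by fact
  interpret A: group ?A using H.subgroup_is_group is_group by blast
  interpret K: normal K ?A using normal_restrict_supergroup HK H.subgroup_axioms by blast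
  interpret Q: group "?A Mod K" by (rule K.factorgroup_is_group)
  have cyc: "cyclic_group (?A Mod K)" using cyclic_quotient_iff assms(4) H.subgroup_axioms K.normal_axioms by blast
  interpret Q: comm_group "?A Mod K" using Q.cyclic_imp_abelian_group cyc by blast
  have pw: "x [^] p \<in> K \<longleftrightarrow> (K #>\<^bsub>?A\<^esub> x) [^]\<^bsub>?A Mod K\<^esub> p = K" if "x \<in> H" for x
    using that K.FactGroup_pow[of x p] K.rcos_eq_one_iff[of "x [^] p"] nat_pow_consistent[of x p H]
      subgroup.subset[OF H.subgroup_axioms] A.nat_pow_closed[of x p] by auto
  have carr: "K #>\<^bsub>?A\<^esub> x \<in> carrier (?A Mod K)" if "x \<in> H" for x
    using that by (auto simp: carrier_FactGroup)
  define P where "P = {x \<in> H. x [^] p \<in> K}"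
  \<comment> \<open>Closure of \<open>P\<close> under products uses that the cyclic quotient is abelian.\<close>
  have "P \<lhd> G"
  proof (rule normal_invI)
    show "subgroup P G"
    proof (rule subgroupI)
      have "\<one> \<in> P" using H.one_closed KG.one_closed by (simp add: P_def)
      then show "P \<noteq> {}" by blast
      fix x y assume x: "x \<in> P" and y: "y \<in> P"
      show "inv x \<in> P" using x H.mem_carrier by (simp add: P_def nat_pow_inv)
      have "(K #>\<^bsub>?A\<^esub> (x \<otimes> y)) = (K #>\<^bsub>?A\<^esub> x) \<otimes>\<^bsub>?A Mod K\<^esub> (K #>\<^bsub>?A\<^esub> y)"
        using x y K.rcos_sum[of x y] by (simp add: P_def)
      then have "(K #>\<^bsub>?A\<^esub> (x \<otimes> y)) [^]\<^bsub>?A Mod K\<^esub> p = K"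
        using x y carr[of x] carr[of y] pw[of x] pw[of y] Q.nat_pow_distrib Q.l_one[OF Q.one_closed]
        by (simp add: P_def)
      then show "x \<otimes> y \<in> P" using x y pw by (simp add: P_def)
    qed (use H.subset in \<open>simp add: P_def subset_iff\<close>)
    fix x g assume x: "x \<in> P" and g: "g \<in> carrier G"
    show "g \<otimes> x \<otimes> inv g \<in> P"
      using x g H.inv_op_closed2 KG.inv_op_closed2 by (simp add: P_def conj_nat_pow)
  qed
  moreover have "K \<subseteq> P" "P \<subseteq> H" using HK subgroup_nat_pow_closed[OF KG.subgroup_axioms] by (auto simp: P_def)
  moreover have "P \<noteq> K"
  proof -
    have "finite (carrier (?A Mod K))"
      using assms(1) finite_subset[OF H.subset] by (simp add: carrier_FactGroup)
    then obtain X where X: "X \<in> carrier (?A Mod K)" "X \<noteq> K" "X [^]\<^bsub>?A Mod K\<^esub> p = K"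
      using Q.exists_element_of_prime_order[OF _ assms(2) True] by auto
    then obtain x where x: "x \<in> H" "X = K #>\<^bsub>?A\<^esub> x" by (auto simp: carrier_FactGroup)
    have "x \<in> P" using x X pw by (simp add: P_def)
    moreover have "x \<notin> K" using x X K.rcos_eq_one_iff by auto
    ultimately show ?thesis by blast
  qed
  ultimately have "P = H" using assms(3) unfolding chief_factor_def by blast
  obtain g where g: "g \<in> carrier (?A Mod K)" "order (?A Mod K) = Q.ord g"
    using Q.cyclic_group_order_eq_ord[OF cyc] .
  obtain x where x: "x \<in> H" "g = K #>\<^bsub>?A\<^esub> x" using g by (auto simp: carrier_FactGroup)
  have "g [^]\<^bsub>?A Mod K\<^esub> p = \<one>\<^bsub>?A Mod K\<^esub>" using x pw \<open>P = H\<close> by (auto simp: P_def)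
  then have "Q.ord g dvd p" using Q.pow_eq_id g by blast
  then show ?thesis using True g(2) by (auto intro: dvd_antisym)
qed simp

text \<open>A chief factor \<open>H / K\<close> is covered at the first term \<open>B\<close> of the series with \<open>H \<inter> B\<close> not inside \<open>K\<close>.  If
  \<open>A\<close> is the term before \<open>B\<close>, then \<open>H / K\<close> is a quotient of \<open>(H \<inter> B) / (H \<inter> A)\<close> and hence inherits
  being cyclic, or being a \<open>p'\<close>-group when \<open>B = M\<close> is the lowest term.\<close>

lemma (in group) p_supersolvableI:
  assumes "finite (carrier G)" "prime p" "M \<lhd> G" "coprime_mod G p M {\<one>}" "cyclic_series G M (carrier G)"
  shows "p_supersolvable p G"
  unfolding p_supersolvable_def
proof (intro conjI allI impI)
  fix H K assume chief: "chief_factor G H K"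
  then have HK: "H \<lhd> G" "K \<lhd> G" "K \<subset> H" by (auto simp: chief_factor_def)
  interpret H: normal H G by fact
  interpret K: normal K G by fact
  interpret F: group "G Mod K" by (rule K.factorgroup_is_group)
  have "H \<inter> B \<subseteq> K \<or> coprime_mod G p H K \<or> cyclic_mod G H K" if "cyclic_series G M B" for B
    using that
  proof induction
    case base
    have "coprime_mod G p H K" if H: "\<forall>x\<in>H. \<exists>b\<in>H \<inter> M. K #> x = K #> b"
      unfolding K.coprime_mod_iff_coset_powers[OF H.subset]
    proof
      fix x assume "x \<in> H"
      then obtain b where b: "b \<in> H" "b \<in> M" "K #> x = K #> b" using H by blast
      then obtain n where n: "coprime n p" "b [^] (n::nat) = \<one>" using assms(4) by (auto simp: coprime_mod_def)
      with b have "(K #> x) [^]\<^bsub>G Mod K\<^esub> n = K" by (simp add: K.FactGroup_pow K.subset)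
      with n show "\<exists>n::nat. coprime n p \<and> (K #> x) [^]\<^bsub>G Mod K\<^esub> n = K" by blast
    qed
    then show ?case using chief_factor_Int_cases[OF chief assms(3)] by blast
  next
    case (step A B)
    have AG: "A \<lhd> G" using step(1) cyclic_series_normal assms(3) by blast
    have "cyclic_mod G H K" if AK: "H \<inter> A \<subseteq> K" and H: "\<forall>x\<in>H. \<exists>b\<in>H \<inter> B. K #> x = K #> b"
    proof -
      have "cyclic_mod G (B \<inter> H) (A \<inter> H)"
        using cyclic_mod_Int[OF assms(1) AG normal_imp_subgroup[OF step(3)] H.subgroup_axioms step(4)] .
      then have "cyclic_mod G (H \<inter> B) K" using AK unfolding cyclic_mod_def by (metis Int_commute subsetD)
      moreover have "H \<inter> B \<subseteq> carrier G" using H.subset by blast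
      ultimately obtain h where h: "h \<in> H \<inter> B"
        "\<And>b. b \<in> H \<inter> B \<Longrightarrow> \<exists>i::int. K #> b = (K #> h) [^]\<^bsub>G Mod K\<^esub> i"
        unfolding K.cyclic_mod_iff_coset_powers[OF \<open>H \<inter> B \<subseteq> carrier G\<close>] by blast
      have "\<exists>i::int. K #> x = (K #> h) [^]\<^bsub>G Mod K\<^esub> i" if "x \<in> H" for x
        using H h(2) that by metis
      with h(1) show ?thesis unfolding K.cyclic_mod_iff_coset_powers[OF H.subset] by blast
    qed
    then show ?case using step(5) chief_factor_Int_cases[OF chief step(3)] by blast
  qed
  from this[OF assms(5)] have "coprime_mod G p H K \<or> cyclic_mod G H K" using HK H.subset by blast
  moreover have "K \<lhd> G\<lparr>carrier := H\<rparr>" using normal_restrict_supergroup HK H.subgroup_axioms by blast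
  ultimately show "order (G\<lparr>carrier := H\<rparr> Mod K) = p \<or> \<not> p dvd order (G\<lparr>carrier := H\<rparr> Mod K)"
    using cyclic_chief_factor_order[OF assms(1,2) chief] coprime_order_quotient_iff[OF H.subgroup_axioms _ assms(1,2)]
    by blast
qed (use assms(1) is_group in auto)

section \<open>Structure of solvable p-supersolvable groups\<close>

lemma (in group) centralizer_in_normal_is_normal:
  assumes "L \<lhd> G" "M \<lhd> G"
  shows "{x \<in> M. \<forall>l\<in>L. x \<otimes> l = l \<otimes> x} \<lhd> G"
proof -
  interpret L: normal L G by fact
  interpret M: normal M G by fact
  have comm_iff: "x \<otimes> l = l \<otimes> x \<longleftrightarrow> x \<otimes> l \<otimes> inv x = l" if "x \<in> carrier G" "l \<in> carrier G" for x l
    using that by (metis inv_solve_right m_closed)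
  show ?thesis
  proof (rule normal_invI)
    show "subgroup {x \<in> M. \<forall>l\<in>L. x \<otimes> l = l \<otimes> x} G"
    proof (rule subgroupI)
      have "\<one> \<in> {x \<in> M. \<forall>l\<in>L. x \<otimes> l = l \<otimes> x}" using L.mem_carrier by simp
      then show "{x \<in> M. \<forall>l\<in>L. x \<otimes> l = l \<otimes> x} \<noteq> {}" by blast
    next
      fix x assume x: "x \<in> {x \<in> M. \<forall>l\<in>L. x \<otimes> l = l \<otimes> x}"
      have "inv x \<otimes> l = l \<otimes> inv x" if l: "l \<in> L" for l
      proof -
        have "l \<otimes> x = x \<otimes> l" using x l by simp
        then have "inv x \<otimes> (l \<otimes> x) \<otimes> inv x = inv x \<otimes> (x \<otimes> l) \<otimes> inv x" by simp
        moreover have "x \<in> carrier G" "l \<in> carrier G" using x l L.mem_carrier M.mem_carrier by blast+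
        ultimately show ?thesis by (simp add: m_assoc inv_cancel_left)
      qed
      then show "inv x \<in> {x \<in> M. \<forall>l\<in>L. x \<otimes> l = l \<otimes> x}" using x by blast
    next
      fix x y assume xy: "x \<in> {x \<in> M. \<forall>l\<in>L. x \<otimes> l = l \<otimes> x}" "y \<in> {x \<in> M. \<forall>l\<in>L. x \<otimes> l = l \<otimes> x}"
      have "x \<otimes> y \<otimes> l = l \<otimes> (x \<otimes> y)" if l: "l \<in> L" for l
      proof -
        have G: "x \<in> carrier G" "y \<in> carrier G" "l \<in> carrier G" using xy l L.mem_carrier M.mem_carrier by blast+
        have "x \<otimes> l = l \<otimes> x" "y \<otimes> l = l \<otimes> y" using xy l by blast+
        then show ?thesis using G by (metis m_assoc)
      qed
      then show "x \<otimes> y \<in> {x \<in> M. \<forall>l\<in>L. x \<otimes> l = l \<otimes> x}" using xy by blast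
    qed (use M.subset in blast)
    fix x g assume x: "x \<in> {x \<in> M. \<forall>l\<in>L. x \<otimes> l = l \<otimes> x}" and g: "g \<in> carrier G"
    have xG: "x \<in> carrier G" using x M.mem_carrier by blast
    have "(g \<otimes> x \<otimes> inv g) \<otimes> l = l \<otimes> (g \<otimes> x \<otimes> inv g)" if l: "l \<in> L" for l
    proof -
      have lG: "l \<in> carrier G" using l by (rule L.mem_carrier)
      have "x \<otimes> (inv g \<otimes> l \<otimes> g) = (inv g \<otimes> l \<otimes> g) \<otimes> x" using x l g L.inv_op_closed1 by blast
      then have "g \<otimes> (x \<otimes> (inv g \<otimes> l \<otimes> g)) \<otimes> inv g = g \<otimes> ((inv g \<otimes> l \<otimes> g) \<otimes> x) \<otimes> inv g" by simp
      then show ?thesis using xG g lG by (simp add: m_assoc inv_cancel_left)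
    qed
    then show "g \<otimes> x \<otimes> inv g \<in> {x \<in> M. \<forall>l\<in>L. x \<otimes> l = l \<otimes> x}"
      using x g M.inv_op_closed2 by blast
  qed
qed

text \<open>Otherwise some term \<open>D\<close> of the derived series meets the centralizer \<open>C\<close> in a group \<open>B\<close> not contained in
  \<open>L\<close> although \<open>[B, B] \<le> L\<close>.  For \<open>x, y \<in> B\<close> the commutator \<open>z = [x, y]\<close> lies in \<open>L\<close>, so
  \<open>z [^] p = \<one>\<close> and \<open>z\<close> is centralized by \<open>B\<close>; and as \<open>x [^] n \<in> L\<close> for some \<open>n\<close> prime to \<open>p\<close>, also
  \<open>z [^] n = \<one>\<close>.  Thus \<open>B\<close> is abelian, its elements of order prime to \<open>p\<close> form a normal subgroup, which is
  trivial by hypothesis, and \<open>B\<close> is contained in \<open>L\<close> after all.\<close>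

lemma (in group) centralizer_le_if_no_pprime_normal:
  assumes "solvable G"
    and "L \<lhd> G" "M \<lhd> G" "coprime_mod G p M L"
    and exp: "\<And>x. x \<in> L \<Longrightarrow> x [^] p = \<one>"
    and core: "\<And>E. E \<lhd> G \<Longrightarrow> coprime_mod G p E {\<one>} \<Longrightarrow> E = {\<one>}"
  shows "{x \<in> M. \<forall>l\<in>L. x \<otimes> l = l \<otimes> x} \<subseteq> L"
proof -
  interpret L: normal L G by fact
  interpret M: normal M G by fact
  define C where "C = {x \<in> M. \<forall>l\<in>L. x \<otimes> l = l \<otimes> x}"
  define D where "D k = (derived G ^^ k) (carrier G)" for k
  interpret C: normal C G
    unfolding C_def using assms(2,3) by (rule centralizer_in_normal_is_normal)
  have DN: "D k \<lhd> G" for k unfolding D_def by (induction k) (auto intro: normal_self derived_is_normal)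
  obtain m where m: "D m = {\<one>}" using assms(1) unfolding solvable_iff_trivial_derived_seq D_def by blast
  have step: "C \<inter> D k \<subseteq> L" if IH: "C \<inter> D (Suc k) \<subseteq> L" for k
  proof -
    interpret D: normal "D k" G by (rule DN)
    have BG: "C \<inter> D k \<lhd> G" using C.normal_axioms DN normal_subgroup_intersect by blast
    have comm: "x \<otimes> y = y \<otimes> x" if x: "x \<in> C \<inter> D k" and y: "y \<in> C \<inter> D k" for x y
    proof -
      have xy: "x \<in> carrier G" "y \<in> carrier G" using x y C.mem_carrier by auto
      define z where "z = x \<otimes> y \<otimes> inv x \<otimes> inv y"
      have "z \<in> derived_set G (D k)" using x y unfolding z_def by blast
      then have "z \<in> derived G (D k)" unfolding derived_def by (rule generate.incl)
      then have "z \<in> D (Suc k)" by (simp add: D_def)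
      moreover have "z \<in> C" unfolding z_def using x y by simp
      ultimately have z: "z \<in> L" using IH by blast
      have zG: "z \<in> carrier G" using z by (rule L.mem_carrier)
      have xyz: "x \<otimes> y = z \<otimes> (y \<otimes> x)" using xy by (simp add: z_def m_assoc inv_cancel_left)
      obtain n where n: "coprime n p" "x [^] (n::nat) \<in> L"
        using x assms(4) by (auto simp: coprime_mod_def C_def)
      have "x \<otimes> z = z \<otimes> x" using x z by (simp add: C_def)
      then have "x [^] n \<otimes> y = z [^] n \<otimes> (y \<otimes> x [^] n)" by (rule pow_commute_factor[OF xy zG xyz])
      moreover have "y \<otimes> x [^] n = x [^] n \<otimes> y" using n y by (simp add: C_def)
      ultimately have "x [^] n \<otimes> y = z [^] n \<otimes> (x [^] n \<otimes> y)" by simp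
      then have "z [^] n = \<one>" using xy zG r_cancel_one'[of "x [^] n \<otimes> y" "z [^] n"] by simp
      then have "z \<in> {\<one>}"
        using mem_if_coprime_powers_mem[OF zG, of n "{\<one>}" p] n(1) exp[OF z] triv_subgroup by simp
      then show ?thesis using xyz xy by simp
    qed
    define E where "E = {x \<in> C \<inter> D k. \<exists>n::nat. coprime n p \<and> x [^] n = \<one>}"
    have "E \<lhd> G"
    proof (rule normal_invI)
      show "subgroup E G"
      proof (rule subgroupI)
        have "coprime 1 p \<and> \<one> [^] (1::nat) = \<one>" by simp
        moreover have "\<one> \<in> C \<inter> D k" by simp
        ultimately have "\<one> \<in> E" unfolding E_def by blast
        then show "E \<noteq> {}" by blast
      next
        fix x assume "x \<in> E"
        then show "inv x \<in> E" unfolding E_def using C.mem_carrier by (auto simp: nat_pow_inv)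
      next
        fix x y assume x: "x \<in> E" and y: "y \<in> E"
        then obtain a b where ab: "coprime a p" "coprime b p" "x [^] (a::nat) = \<one>" "y [^] (b::nat) = \<one>"
          unfolding E_def by blast
        have xy: "x \<in> carrier G" "y \<in> carrier G" using x y C.mem_carrier by (auto simp: E_def)
        have "x \<otimes> y = y \<otimes> x" using x y by (intro comm) (simp_all add: E_def)
        then have "(x \<otimes> y) [^] (a * b) = x [^] (a * b) \<otimes> y [^] (b * a)"
          unfolding mult.commute[of b a] using xy by (rule pow_mult_distrib)
        also have "\<dots> = \<one>" using xy ab by (simp flip: nat_pow_pow)
        finally have "(x \<otimes> y) [^] (a * b) = \<one>" .
        moreover have "coprime (a * b) p" using ab by simp
        moreover have "x \<otimes> y \<in> C \<inter> D k" using x y by (simp add: E_def)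
        ultimately show "x \<otimes> y \<in> E" unfolding E_def by blast
      qed (use C.subset in \<open>auto simp: E_def\<close>)
      fix x g assume x: "x \<in> E" and g: "g \<in> carrier G"
      have xG: "x \<in> carrier G" using x C.mem_carrier by (simp add: E_def)
      obtain n where n: "coprime n p" "x [^] (n::nat) = \<one>" using x by (auto simp: E_def)
      then have "(g \<otimes> x \<otimes> inv g) [^] n = \<one>" using xG g by (simp add: conj_nat_pow)
      moreover have "g \<otimes> x \<otimes> inv g \<in> C \<inter> D k"
        using x g C.inv_op_closed2 D.inv_op_closed2 by (simp add: E_def)
      ultimately show "g \<otimes> x \<otimes> inv g \<in> E" unfolding E_def using n(1) by blast
    qed
    then have E: "E = {\<one>}" by (rule core) (auto simp: E_def coprime_mod_def)
    show ?thesis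
    proof
      fix x assume x: "x \<in> C \<inter> D k"
      then have xG: "x \<in> carrier G" using C.mem_carrier by blast
      obtain n where n: "coprime n p" "x [^] (n::nat) \<in> L"
        using x assms(4) by (auto simp: coprime_mod_def C_def)
      \<comment> \<open>Both \<open>x [^] n\<close> and \<open>x [^] p\<close> lie in \<open>L\<close>, the latter because it has order prime to \<open>p\<close>.\<close>
      have "(x [^] p) [^] n = (x [^] n) [^] p" using xG by (simp add: nat_pow_pow mult.commute)
      also have "\<dots> = \<one>" using exp n by blast
      finally have "x [^] p \<in> E"
        unfolding E_def using n(1) x subgroup_nat_pow_closed[OF normal_imp_subgroup[OF BG]] by blast
      then have "x [^] p \<in> L" using E L.one_closed by simp
      then show "x \<in> L" using mem_if_coprime_powers_mem[OF xG n(2)] n(1) L.subgroup_axioms by blast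
    qed
  qed
  \<comment> \<open>Descend from the trivial term \<open>D m\<close> to \<open>D 0\<close>, the whole group.\<close>
  have "C \<inter> D (m - k) \<subseteq> L" for k
  proof (induction k)
    case 0 show ?case using m L.one_closed by auto
  next
    case (Suc k)
    show ?case
    proof (cases "k < m")
      case True
      then have "m - k = Suc (m - Suc k)" by simp
      with Suc show ?thesis using step by metis
    qed (use Suc in simp)
  qed
  from this[of m] have "C \<inter> carrier G \<subseteq> L" by (simp add: D_def)
  then show ?thesis using C.subset unfolding C_def by blast
qed

text \<open>An endomorphism of a cyclic group raises every element to one fixed power, determined on a
  generator.\<close>

lemma (in group) conj_cyclic_normal_eq_pow:
  assumes "L \<lhd> G" "cyclic_mod G L {\<one>}" "s \<in> carrier G"
  obtains a :: int where "\<And>x. x \<in> L \<Longrightarrow> s \<otimes> x \<otimes> inv s = x [^] a"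
proof -
  interpret L: normal L G by fact
  obtain h where h: "h \<in> L" "\<And>x. x \<in> L \<Longrightarrow> \<exists>i::int. x \<otimes> h [^] i = \<one>"
    using assms(2) by (auto simp: cyclic_mod_def)
  have hG: "h \<in> carrier G" using h L.mem_carrier by blast
  have pow: "\<exists>i::int. x = h [^] i" if x: "x \<in> L" for x
  proof -
    obtain i where "x \<otimes> h [^] (i::int) = \<one>" using h x by blast
    then have "x = h [^] (- i)" using inv_equality[of x "h [^] i"] x hG by (simp add: int_pow_neg L.mem_carrier)
    then show ?thesis by blast
  qed
  interpret conj: group_hom G G "\<lambda>x. s \<otimes> x \<otimes> inv s"
    by unfold_locales (use assms(3) in \<open>auto simp: hom_def m_assoc inv_cancel_left\<close>)
  obtain a where a: "s \<otimes> h \<otimes> inv s = h [^] (a::int)" using pow h(1) L.inv_op_closed2 assms(3) by blast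
  have "s \<otimes> x \<otimes> inv s = x [^] a" if x: "x \<in> L" for x
  proof -
    obtain i where "x = h [^] (i::int)" using pow x by blast
    then show ?thesis using a conj.hom_int_pow[OF hG, of i] hG by (simp add: int_pow_pow mult.commute)
  qed
  then show ?thesis using that by blast
qed

text \<open>Conjugations by \<open>s\<close> and \<open>t\<close> act on \<open>L\<close> as power maps, and power maps commute.\<close>

lemma (in group) commutator_centralizes_cyclic_normal:
  assumes "L \<lhd> G" "cyclic_mod G L {\<one>}" "s \<in> carrier G" "t \<in> carrier G" "y \<in> L"
  shows "(s \<otimes> t \<otimes> inv s \<otimes> inv t) \<otimes> y = y \<otimes> (s \<otimes> t \<otimes> inv s \<otimes> inv t)"
proof -
  interpret L: normal L G by fact
  obtain a b :: int where a: "\<And>x. x \<in> L \<Longrightarrow> s \<otimes> x \<otimes> inv s = x [^] a" and b: "\<And>x. x \<in> L \<Longrightarrow> t \<otimes> x \<otimes> inv t = x [^] b"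
    using conj_cyclic_normal_eq_pow[OF assms(1,2)] assms(3,4) by metis
  \<comment> \<open>Chosen so that conjugation by \<open>t \<otimes> s\<close> maps \<open>x\<close> to \<open>y\<close>.\<close>
  define x where "x = inv s \<otimes> (inv t \<otimes> y \<otimes> t) \<otimes> s"
  have xL: "x \<in> L" unfolding x_def using assms L.inv_op_closed1 by blast
  have G: "x \<in> carrier G" "y \<in> carrier G" using xL assms(5) L.mem_carrier by auto
  have powL: "x [^] i \<in> L" for i :: int using xL subgroup_int_pow_closed L.subgroup_axioms by blast
  have "s \<otimes> (t \<otimes> x \<otimes> inv t) \<otimes> inv s = t \<otimes> (s \<otimes> x \<otimes> inv s) \<otimes> inv t"
    using a b xL powL G by (simp add: int_pow_pow mult.commute)
  also have "\<dots> = y" unfolding x_def using G assms by (simp add: m_assoc inv_cancel_left)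
  finally have "s \<otimes> (t \<otimes> x \<otimes> inv t) \<otimes> inv s = y" .
  then have "s \<otimes> (t \<otimes> x \<otimes> inv t) \<otimes> inv s \<otimes> (s \<otimes> t \<otimes> inv s \<otimes> inv t) = y \<otimes> (s \<otimes> t \<otimes> inv s \<otimes> inv t)"
    by simp
  then show ?thesis unfolding x_def using G assms by (simp add: m_assoc inv_cancel_left)
qed

text \<open>If \<open>M / L\<close> is central in \<open>G / L\<close>, every subgroup between \<open>L\<close> and \<open>M\<close> is normal in \<open>G\<close>.  A series is then
  obtained by adjoining one element after another.\<close>

lemma (in group) cyclic_series_of_central_section:
  assumes "finite (carrier G)" "L \<lhd> G" "M \<lhd> G" "L \<subseteq> M"
    and central: "\<And>s m. s \<in> carrier G \<Longrightarrow> m \<in> M \<Longrightarrow> s \<otimes> m \<otimes> inv s \<otimes> inv m \<in> L"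
  shows "cyclic_series G L M"
proof -
  interpret M: normal M G by fact
  have between: "B \<lhd> G" if B: "subgroup B G" "L \<subseteq> B" "B \<subseteq> M" for B
  proof (rule normal_invI[OF B(1)])
    fix b g assume b: "b \<in> B" and g: "g \<in> carrier G"
    then have "(g \<otimes> b \<otimes> inv g \<otimes> inv b) \<otimes> b \<in> B"
      using central B subgroup.m_closed[OF B(1)] by blast
    then show "g \<otimes> b \<otimes> inv g \<in> B" using g b B M.mem_carrier by (simp add: m_assoc subset_iff)
  qed
  have "cyclic_series G A M" if "A \<lhd> G" "L \<subseteq> A" "A \<subseteq> M" for A
    using that
  proof (induction "card (M - A)" arbitrary: A rule: less_induct)
    case less
    show ?case
    proof (cases "A = M")
      case False
      then obtain x where x: "x \<in> M" "x \<notin> A" using less by blast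
      interpret A: normal A G using less by blast
      \<comment> \<open>\<open>A\<close> is normal, so this product is the subgroup generated by \<open>A\<close> and \<open>x\<close>.\<close>
      define B where "B = A <#> generate G {x}"
      have xG: "x \<in> carrier G" using x M.mem_carrier by blast
      have Bmem: "y \<in> B \<longleftrightarrow> (\<exists>a\<in>A. \<exists>i::int. y = a \<otimes> x [^] i)" for y
        unfolding B_def set_mult_def generate_pow[OF xG] by blast
      have "subgroup B G" unfolding B_def
        using second_isomorphism_grp.normal_set_mult_subgroup[of A G "generate G {x}"] less.prems(1)
          generate_is_subgroup[of "{x}"] xG
        by (simp add: second_isomorphism_grp_def second_isomorphism_grp_axioms_def)
      moreover have AB: "A \<subseteq> B"
        using Bmem by (metis int_pow_0 A.mem_carrier r_one subsetI)
      moreover have BM: "B \<subseteq> M"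
      proof
        fix y assume "y \<in> B"
        then obtain a i where ai: "a \<in> A" "y = a \<otimes> x [^] (i::int)" using Bmem by blast
        have "x [^] i \<in> M" using subgroup_int_pow_closed[OF M.subgroup_axioms x(1)] .
        then show "y \<in> M" using ai less.prems(3) by blast
      qed
      ultimately have BG: "B \<lhd> G" using between less.prems(2) by blast
      have xB: "x \<in> B" unfolding Bmem using xG by (intro bexI[of _ \<one>] exI[of _ "1::int"]) auto
      have "card (M - B) < card (M - A)"
        using AB xB x finite_subset[OF M.subset assms(1)] by (intro psubset_card_mono) auto
      then have "cyclic_series G B M" using less.hyps BG AB BM less.prems(2) by blast
      moreover have "\<exists>i::int. y \<otimes> x [^] i \<in> A" if yB: "y \<in> B" for y
      proof -
        obtain a i where "a \<in> A" "y = a \<otimes> x [^] (i::int)" using yB unfolding Bmem by blast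
        then have "y \<otimes> x [^] (- i) = a" using xG by (simp add: m_assoc int_pow_neg A.mem_carrier)
        with \<open>a \<in> A\<close> show ?thesis by (intro exI[of _ "- i"]) simp
      qed
      then have "cyclic_series G A B"
        using xB AB BG by (intro cyclic_series.step[OF cyclic_series.base]) (auto simp: cyclic_mod_def)
      ultimately show ?thesis by (rule cyclic_series_trans)
    qed (use cyclic_series.base in simp)
  qed
  then show ?thesis using assms by blast
qed

text \<open>The group acts on the cyclic group \<open>L\<close> through an abelian group, so commutators with elements of
  \<open>M\<close> lie in the centralizer of \<open>L\<close> in \<open>M\<close>, which is contained in \<open>L\<close>.\<close>

lemma (in group) cyclic_series_if_no_pprime_normal:
  assumes "finite (carrier G)" "solvable G"
    and "L \<lhd> G" "M \<lhd> G" "L \<subseteq> M" "coprime_mod G p M L"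
    and "cyclic_mod G L {\<one>}" "\<And>x. x \<in> L \<Longrightarrow> x [^] p = \<one>"
    and "\<And>E. E \<lhd> G \<Longrightarrow> coprime_mod G p E {\<one>} \<Longrightarrow> E = {\<one>}"
  shows "cyclic_series G L M"
proof (rule cyclic_series_of_central_section[OF assms(1,3,4,5)])
  interpret M: normal M G by fact
  fix s m assume s: "s \<in> carrier G" and m: "m \<in> M"
  then have "s \<otimes> m \<otimes> inv s \<otimes> inv m \<in> M" using M.inv_op_closed2 by blast
  then have "s \<otimes> m \<otimes> inv s \<otimes> inv m \<in> {x \<in> M. \<forall>l\<in>L. x \<otimes> l = l \<otimes> x}"
    using commutator_centralizes_cyclic_normal[OF assms(3,7) s M.mem_carrier[OF m]] by blast
  then show "s \<otimes> m \<otimes> inv s \<otimes> inv m \<in> L"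
    using centralizer_le_if_no_pprime_normal[OF assms(2-4,6,8,9)] by blast
qed

lemma (in group) chief_factor_exists:
  assumes "finite (carrier G)" "N \<lhd> G" "N \<noteq> carrier G"
  obtains L where "chief_factor G L N"
proof -
  define S where "S = {L. L \<lhd> G \<and> N \<subset> L}"
  have "S \<subseteq> Pow (carrier G)" unfolding S_def using normal_imp_subgroup subgroup.subset by blast
  then have "finite S" using assms(1) finite_subset by blast
  moreover have "carrier G \<in> S"
    unfolding S_def using normal_self assms(2,3) normal_imp_subgroup subgroup.subset by blast
  ultimately obtain L where "L \<in> S" "\<And>L'. L' \<in> S \<Longrightarrow> L' \<subseteq> L \<Longrightarrow> L = L'"
    using finite_has_minimal[of S] by blast
  then have "L \<lhd> G" "N \<subset> L" "\<not> (\<exists>L'. L' \<lhd> G \<and> N \<subset> L' \<and> L' \<subset> L)"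
    unfolding S_def by auto
  then have "chief_factor G L N" using assms(2) unfolding chief_factor_def by blast
  then show ?thesis by (rule that)
qed

lemma (in group) cyclic_mod_quotient_of_prime_order:
  assumes "finite (carrier G)" "prime p" "L \<lhd> G" "N \<lhd> G" "N \<subseteq> L"
    and "order (G\<lparr>carrier := L\<rparr> Mod N) = p"
  shows "cyclic_mod G L N" "\<And>x. x \<in> L \<Longrightarrow> x [^] p \<in> N"
proof -
  interpret L: normal L G by fact
  have N: "N \<lhd> G\<lparr>carrier := L\<rparr>" using normal_restrict_supergroup L.subgroup_axioms assms by blast
  interpret N: normal N "G\<lparr>carrier := L\<rparr>" by (rule N)
  interpret Q: group "G\<lparr>carrier := L\<rparr> Mod N" by (rule N.factorgroup_is_group)
  show "cyclic_mod G L N"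
    using Q.prime_order_cyclic assms(2,6) cyclic_quotient_iff[OF L.subgroup_axioms N] by blast
  fix x assume x: "x \<in> L"
  have "(N #>\<^bsub>G\<lparr>carrier := L\<rparr>\<^esub> x) [^]\<^bsub>G\<lparr>carrier := L\<rparr> Mod N\<^esub> p = N"
    using Q.pow_order_eq_1[of "N #>\<^bsub>G\<lparr>carrier := L\<rparr>\<^esub> x"] x assms(6) by (simp add: carrier_FactGroup)
  then have "N #>\<^bsub>G\<lparr>carrier := L\<rparr>\<^esub> (x [^] p) = N"
    using N.FactGroup_pow[of x p] x by (simp flip: nat_pow_consistent)
  then show "x [^] p \<in> N"
    using N.rcos_eq_one_iff[of "x [^] p"] subgroup_nat_pow_closed[OF L.subgroup_axioms x] by simp
qed

text \<open>Induction on the index of \<open>N\<close>.  If some normal \<open>p'\<close>-section \<open>L / N\<close> is nontrivial, the group \<open>M\<close> found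
  above \<open>L\<close> works for \<open>N\<close> too.  Otherwise a chief factor \<open>L / N\<close> has order \<open>p\<close>, and the quotient by \<open>N\<close>
  satisfies the assumptions of \<open>cyclic_series_if_no_pprime_normal\<close>; then \<open>M = N\<close> itself works.\<close>

lemma (in group) p_supersolvable_imp_series:
  assumes "finite (carrier G)" "solvable G" "prime p" "p_supersolvable p G" "N \<lhd> G"
  shows "\<exists>M. M \<lhd> G \<and> N \<subseteq> M \<and> coprime_mod G p M N \<and> cyclic_series G M (carrier G)"
  using assms(5)
proof (induction "card (carrier G - N)" arbitrary: N rule: less_induct)
  case less
  interpret N: normal N G by fact
  have refl: "coprime_mod G p N N" unfolding coprime_mod_def
    using N.mem_carrier nat_pow_eone coprime_1_left by metis
  have IH: "\<exists>M. M \<lhd> G \<and> L \<subseteq> M \<and> coprime_mod G p M L \<and> cyclic_series G M (carrier G)" if "L \<lhd> G" "N \<subset> L" for L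
  proof (rule less.hyps[OF _ that(1)])
    have "L \<subseteq> carrier G" using that(1) normal_imp_subgroup subgroup.subset by blast
    then show "card (carrier G - L) < card (carrier G - N)"
      using that(2) assms(1) by (intro psubset_card_mono) auto
  qed
  consider "N = carrier G" | L where "L \<lhd> G" "N \<subset> L" "coprime_mod G p L N"
    | "N \<noteq> carrier G" "\<And>L. L \<lhd> G \<Longrightarrow> N \<subset> L \<Longrightarrow> \<not> coprime_mod G p L N" by blast
  then show ?case
  proof cases
    case 1
    then show ?thesis using less.prems refl cyclic_series.base by blast
  next
    case 2
    then obtain M where M: "M \<lhd> G" "L \<subseteq> M" "coprime_mod G p M L" "cyclic_series G M (carrier G)"
      using IH by blast
    have "M \<subseteq> carrier G" using M(1) normal_imp_subgroup subgroup.subset by blast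
    then have "coprime_mod G p M N" using coprime_mod_trans[OF is_group] M(3) 2(3) by blast
    with M 2 show ?thesis by blast
  next
    case 3
    obtain L where chief: "chief_factor G L N" using chief_factor_exists[OF assms(1) less.prems 3(1)] .
    then have L: "L \<lhd> G" "N \<subset> L" by (auto simp: chief_factor_def)
    interpret L: normal L G by fact
    have "N \<lhd> G\<lparr>carrier := L\<rparr>" using normal_restrict_supergroup L.subgroup_axioms less.prems L(2) by blast
    then have "order (G\<lparr>carrier := L\<rparr> Mod N) = p"
      using assms(4) chief 3(2)[OF L] coprime_order_quotient_iff[OF L.subgroup_axioms _ assms(1,3)]
      unfolding p_supersolvable_def by blast
    note LN = cyclic_mod_quotient_of_prime_order[OF assms(1,3) L(1) less.prems psubset_imp_subset[OF L(2)] this]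
    obtain M where M: "M \<lhd> G" "L \<subseteq> M" "coprime_mod G p M L" "cyclic_series G M (carrier G)"
      using IH L by blast
    interpret M: normal M G by fact
    interpret F: group "G Mod N" by (rule N.factorgroup_is_group)
    interpret \<pi>: group_hom G "G Mod N" "\<lambda>x. N #> x" by (rule N.group_hom_FactGroup)
    have surj: "(\<lambda>x. N #> x) ` carrier G = carrier (G Mod N)" by (simp add: carrier_FactGroup)
    have "cyclic_series (G Mod N) ((\<lambda>x. N #> x) ` L) ((\<lambda>x. N #> x) ` M)"
    proof (rule F.cyclic_series_if_no_pprime_normal)
      show "finite (carrier (G Mod N))" using assms(1) by (simp add: carrier_FactGroup)
      show "solvable (G Mod N)" using \<pi>.surj_hom_imp_solvable surj assms(2) by blast
      show "(\<lambda>x. N #> x) ` L \<lhd> G Mod N" using L.surj_hom_normal_subgroup \<pi>.group_hom_axioms surj by blast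
      show "(\<lambda>x. N #> x) ` M \<lhd> G Mod N" using M.surj_hom_normal_subgroup \<pi>.group_hom_axioms surj by blast
      show "(\<lambda>x. N #> x) ` L \<subseteq> (\<lambda>x. N #> x) ` M" using M(2) by blast
      show "coprime_mod (G Mod N) p ((\<lambda>x. N #> x) ` M) ((\<lambda>x. N #> x) ` L)"
        using \<pi>.coprime_mod_image[OF M.subset M(3)] .
      show "cyclic_mod (G Mod N) ((\<lambda>x. N #> x) ` L) {\<one>\<^bsub>G Mod N\<^esub>}"
        using \<pi>.cyclic_mod_image[OF L.subset LN(1)] unfolding N.rcos_image_self .
      show "x [^]\<^bsub>G Mod N\<^esub> p = \<one>\<^bsub>G Mod N\<^esub>" if "x \<in> (\<lambda>x. N #> x) ` L" for x
      proof -
        from that obtain y where y: "y \<in> L" "x = N #> y" by blast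
        have yG: "y \<in> carrier G" using y(1) by (rule L.mem_carrier)
        have "N #> (y [^] p) = N" using N.rcos_eq_one_iff[of "y [^] p"] LN(2)[OF y(1)] yG by blast
        then show ?thesis using N.FactGroup_pow[OF yG, of p] y(2) by simp
      qed
      fix E assume E: "E \<lhd> G Mod N" "coprime_mod (G Mod N) p E {\<one>\<^bsub>G Mod N\<^esub>}"
      interpret E: normal E "G Mod N" by fact
      \<comment> \<open>A normal \<open>p'\<close>-subgroup of the quotient pulls back to a normal \<open>p'\<close>-section above \<open>N\<close>.\<close>
      define E' where "E' = {x \<in> carrier G. N #> x \<in> E}"
      have "coprime_mod G p E' N"
        unfolding E'_def using \<pi>.coprime_mod_vimage[OF E(2)] unfolding N.rcos_vimage_one .
      moreover have "E' \<lhd> G" unfolding E'_def using \<pi>.normal_vimage[OF E(1)] .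
      moreover have "N \<subseteq> E'"
        unfolding E'_def using N.rcos_const[OF is_group] N.subset E.one_closed by auto
      ultimately have "E' = N" using 3(2) by blast
      have "E \<subseteq> (\<lambda>x. N #> x) ` E'"
      proof
        fix X assume X: "X \<in> E"
        then have "X \<in> (\<lambda>x. N #> x) ` carrier G" using E.subset unfolding surj by (rule subsetD[rotated])
        then obtain x where "x \<in> carrier G" "X = N #> x" by (rule imageE)
        with X show "X \<in> (\<lambda>x. N #> x) ` E'" unfolding E'_def by simp
      qed
      then show "E = {\<one>\<^bsub>G Mod N\<^esub>}" using \<open>E' = N\<close> N.rcos_image_self E.one_closed by auto
    qed
    then have "cyclic_series G {x \<in> carrier G. N #> x \<in> (\<lambda>x. N #> x) ` L} {x \<in> carrier G. N #> x \<in> (\<lambda>x. N #> x) ` M}"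
      using \<pi>.cyclic_series_vimage[OF surj] L.surj_hom_normal_subgroup \<pi>.group_hom_axioms surj by blast
    then have "cyclic_series G L M"
      using N.rcos_vimage_image[OF L.subgroup_axioms] N.rcos_vimage_image[OF M.subgroup_axioms] L(2) M(2) by simp
    moreover have "cyclic_series G N L"
      using cyclic_series.step[OF cyclic_series.base _ L(1) LN(1)] L(2) by blast
    ultimately have "cyclic_series G N (carrier G)" using M(4) cyclic_series_trans by metis
    then show ?thesis using less.prems refl by blast
  qed
qed

section \<open>The subgroup generated by the p-elements\<close>

text \<open>For a finite subgroup \<open>X\<close> and a prime \<open>p\<close> this is the \<open>p'\<close>-residual of \<open>X\<close>.  It is encoded by generators,
  which makes its invariance under all automorphisms of \<open>X\<close> evident.\<close>

definition pprime_residual :: "('a, 'b) monoid_scheme \<Rightarrow> nat \<Rightarrow> 'a set \<Rightarrow> 'a set"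
  where "pprime_residual G p X = generate G {x \<in> X. \<exists>k::nat. x [^]\<^bsub>G\<^esub> (p ^ k) = \<one>\<^bsub>G\<^esub>}"

lemma (in group) pprime_residual_subset:
  assumes "subgroup X G"
  shows "pprime_residual G p X \<subseteq> X"
  unfolding pprime_residual_def by (rule generate_subgroup_incl[OF _ assms]) blast

lemma (in group) pprime_residual_normal:
  assumes "X \<lhd> G"
  shows "pprime_residual G p X \<lhd> G"
  unfolding pprime_residual_def
proof (rule normal_generateI)
  interpret X: normal X G by fact
  show "{x \<in> X. \<exists>k::nat. x [^] (p ^ k) = \<one>} \<subseteq> carrier G" using X.subset by blast
  fix x g assume "x \<in> {x \<in> X. \<exists>k::nat. x [^] (p ^ k) = \<one>}" and g: "g \<in> carrier G"
  then obtain k where x: "x \<in> X" "x [^] (p ^ k) = \<one>" by blast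
  then have "(g \<otimes> x \<otimes> inv g) [^] (p ^ k) = \<one>" using g X.mem_carrier by (simp add: conj_nat_pow)
  moreover have "g \<otimes> x \<otimes> inv g \<in> X" using x g X.inv_op_closed2 by blast
  ultimately show "g \<otimes> x \<otimes> inv g \<in> {x \<in> X. \<exists>k::nat. x [^] (p ^ k) = \<one>}" by blast
qed

text \<open>If \<open>x\<close> has order \<open>p ^ a * m\<close> with \<open>m\<close> prime to \<open>p\<close>, then \<open>x [^] m\<close> has \<open>p\<close>-power order.\<close>

lemma (in group) coprime_mod_pprime_residual:
  assumes "finite (carrier G)" "prime p" "subgroup X G"
  shows "coprime_mod G p X (pprime_residual G p X)"
  unfolding coprime_mod_def
proof
  fix x assume x: "x \<in> X"
  then have xG: "x \<in> carrier G" using assms(3) subgroup.mem_carrier by metis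
  have "0 < order G" using assms(1) order_gt_0_iff_finite by simp
  then have "ord x \<noteq> 0" using ord_dvd_group_order[OF xG] by (metis dvd_0_left_iff less_irrefl)
  moreover have "\<not> is_unit p" using assms(2) not_prime_unit by blast
  ultimately obtain m where m: "ord x = p ^ multiplicity p (ord x) * m" "\<not> p dvd m"
    using multiplicity_decompose' by metis
  have "(x [^] m) [^] (p ^ multiplicity p (ord x)) = x [^] ord x"
    using xG m(1) by (simp add: nat_pow_pow mult.commute)
  then have "(x [^] m) [^] (p ^ multiplicity p (ord x)) = \<one>" using xG by simp
  moreover have "x [^] m \<in> X" using subgroup_nat_pow_closed[OF assms(3) x] .
  ultimately have "x [^] m \<in> pprime_residual G p X"
    unfolding pprime_residual_def by (intro generate.incl) blast
  moreover have "coprime m p" using m(2) assms(2) by (metis coprime_commute prime_imp_coprime)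
  ultimately show "\<exists>n::nat. coprime n p \<and> x [^] n \<in> pprime_residual G p X" by blast
qed

lemma (in group) pprime_residual_minimal:
  assumes "subgroup X G" "subgroup R G" "coprime_mod G p X R"
  shows "pprime_residual G p X \<subseteq> R"
  unfolding pprime_residual_def
proof (rule generate_subgroup_incl[OF _ assms(2)], safe)
  fix x k assume x: "x \<in> X" "x [^] (p ^ k :: nat) = \<one>"
  obtain n where n: "coprime n p" "x [^] (n::nat) \<in> R" using assms(3) x by (auto simp: coprime_mod_def)
  have "x [^] (p ^ k :: nat) \<in> R" using x(2) subgroup.one_closed[OF assms(2)] by simp
  moreover have "coprime n (p ^ k)" using n(1) by simp
  ultimately show "x \<in> R"
    using mem_if_coprime_powers_mem[OF _ n(2)] subgroup.mem_carrier[OF assms(1) x(1)] assms(2) by blast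
qed

text \<open>\<open>X\<close> equals the join \<open>J\<close> of its \<open>p'\<close>-residuals: for \<open>x \<in> X\<close> the order of \<open>x\<close> modulo \<open>J\<close> is prime to
  every prime divisor \<open>p\<close> of the order of \<open>H\<close>, since the \<open>p'\<close>-residual of \<open>X\<close> lies in \<open>J\<close>, and to every other
  prime, since it divides the order of \<open>H\<close>.\<close>

lemma (in group) normal_if_pprime_residuals_normal:
  assumes "finite (carrier G)" "subgroup H G" "subgroup X G" "X \<subseteq> H"
    and norm: "\<And>p. p \<in> prime_factors (card H) \<Longrightarrow> pprime_residual G p X \<lhd> G"
  shows "X \<lhd> G"
proof -
  define J where "J = generate G (\<Union>p\<in>prime_factors (card H). pprime_residual G p X)"
  have sub: "(\<Union>p\<in>prime_factors (card H). pprime_residual G p X) \<subseteq> X"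
    using pprime_residual_subset[OF assms(3)] by blast
  have "J \<lhd> G" unfolding J_def
  proof (rule normal_generateI)
    show "(\<Union>p\<in>prime_factors (card H). pprime_residual G p X) \<subseteq> carrier G"
      using sub subgroup.subset[OF assms(3)] by blast
    show "g \<otimes> h \<otimes> inv g \<in> (\<Union>p\<in>prime_factors (card H). pprime_residual G p X)"
      if "h \<in> (\<Union>p\<in>prime_factors (card H). pprime_residual G p X)" "g \<in> carrier G" for h g
    proof -
      from that(1) obtain p where p: "p \<in> prime_factors (card H)" "h \<in> pprime_residual G p X" by blast
      then have "g \<otimes> h \<otimes> inv g \<in> pprime_residual G p X"
        using normal.inv_op_closed2[OF norm] that(2) by blast
      with p(1) show ?thesis by blast
    qed
  qed
  then interpret J: normal J G .
  interpret F: group "G Mod J" by (rule J.factorgroup_is_group)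
  have "J \<subseteq> X" unfolding J_def using sub assms(3) by (rule generate_subgroup_incl)
  moreover have "X \<subseteq> J"
  proof
    fix x assume x: "x \<in> X"
    then have xG: "x \<in> carrier G" using assms(3) subgroup.mem_carrier by metis
    have pow: "F.ord (J #> x) dvd n \<longleftrightarrow> x [^] n \<in> J" for n :: nat
      using xG F.pow_eq_id[of "J #> x" n] by (simp add: carrier_FactGroup J.FactGroup_pow J.rcos_eq_one_iff)
    have ex: "\<exists>n::nat. coprime n p \<and> x [^] n \<in> J" if p: "prime p" for p
    proof (cases "p \<in> prime_factors (card H)")
      case True
      then obtain n where n: "coprime n p" "x [^] (n::nat) \<in> pprime_residual G p X"
        using coprime_mod_pprime_residual[OF assms(1) p assms(3)] x unfolding coprime_mod_def by blast
      then have "x [^] n \<in> J" unfolding J_def using True by (intro generate.incl) blast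
      with n show ?thesis by blast
    next
      case False
      have "finite H" using assms(1,2) finite_subset subgroup.subset by metis
      then have "card H \<noteq> 0" using x assms(4) by auto
      then have "coprime (card H) p" using False p by (metis coprime_commute in_prime_factors_iff prime_imp_coprime)
      moreover have "x [^] card H = \<one>"
        using group.pow_order_eq_1[OF subgroup_imp_group[OF assms(2)], of x] x assms(4)
        by (auto simp: order_def simp flip: nat_pow_consistent)
      ultimately show ?thesis using J.one_closed by metis
    qed
    have "F.ord (J #> x) = 1"
    proof (rule ccontr)
      assume "F.ord (J #> x) \<noteq> 1"
      then obtain p where p: "prime p" "p dvd F.ord (J #> x)" using prime_factor_nat by blast
      then obtain n where n: "coprime n p" "x [^] (n::nat) \<in> J" using ex by blast
      then have "p dvd n" using p(2) pow dvd_trans by blast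
      then show False using n(1) p(1) by (metis coprime_common_divisor dvd_refl not_prime_unit)
    qed
    then show "x \<in> J" using pow[of 1] xG by simp
  qed
  ultimately show ?thesis using \<open>J \<lhd> G\<close> by simp
qed

section \<open>Residuals\<close>

lemma (in group) residual_subgroup: "subgroup (residual F G) G"
proof -
  have "residual F G = \<Inter> (insert (carrier G) {N. N \<lhd> G \<and> F (G Mod N)})" by (simp add: residual_def)
  then show ?thesis
    using subgroups_Inter[of "insert (carrier G) {N. N \<lhd> G \<and> F (G Mod N)}"] subgroup_self normal_imp_subgroup
    by auto
qed

text \<open>The normal subgroups with supersolvable quotient are closed under intersection, so a minimal
  one is the least one.\<close>

lemma (in group) supersolvable_residual:
  assumes "finite (carrier G)"
  shows "residual supersolvable G \<lhd> G"
    and "cyclic_series G (residual supersolvable G) (carrier G)"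
    and "N \<lhd> G \<Longrightarrow> cyclic_series G N (carrier G) \<Longrightarrow> residual supersolvable G \<subseteq> N"
proof -
  define S where "S = {N. N \<lhd> G \<and> cyclic_series G N (carrier G)}"
  have S: "S = {N. N \<lhd> G \<and> supersolvable (G Mod N)}"
    unfolding S_def using normal.supersolvable_FactGroup_iff by blast
  have "S \<subseteq> Pow (carrier G)" unfolding S_def using normal_imp_subgroup subgroup.subset by blast
  then have "finite S" using assms finite_subset by blast
  moreover have "carrier G \<in> S" unfolding S_def using normal_self cyclic_series.base by blast
  ultimately obtain R where R: "R \<in> S" and min: "\<forall>N\<in>S. N \<subseteq> R \<longrightarrow> R = N"
    using finite_has_minimal[of S] by blast
  have le: "R \<subseteq> N" if N: "N \<in> S" for N
  proof -
    have RN: "R \<lhd> G" "N \<lhd> G" "cyclic_series G R (carrier G)" "cyclic_series G N (carrier G)"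
      using R N by (auto simp: S_def)
    \<comment> \<open>A series from \<open>R \<inter> N\<close> to \<open>N\<close>, continued by one from \<open>N\<close> to the top.\<close>
    have "cyclic_series G (R \<inter> N) (carrier G \<inter> N)"
      using cyclic_series_Int[OF assms RN(1,2,3)] .
    moreover have "carrier G \<inter> N = N" using RN(2) normal_imp_subgroup subgroup.subset by blast
    ultimately have "cyclic_series G (R \<inter> N) (carrier G)" using RN(4) cyclic_series_trans by metis
    then have "R \<inter> N \<in> S" unfolding S_def using normal_subgroup_intersect RN(1,2) by blast
    then show ?thesis using min by blast
  qed
  have "residual supersolvable G = carrier G \<inter> \<Inter>S" by (simp add: residual_def S)
  also have "\<dots> = R" using le R \<open>S \<subseteq> Pow (carrier G)\<close> by blast
  finally have "residual supersolvable G = R" .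
  then show "residual supersolvable G \<lhd> G" "cyclic_series G (residual supersolvable G) (carrier G)"
    "N \<lhd> G \<Longrightarrow> cyclic_series G N (carrier G) \<Longrightarrow> residual supersolvable G \<subseteq> N"
    using R le by (auto simp: S_def)
qed

text \<open>Let \<open>X\<close> be the supersolvable residual.  The quotient by its \<open>p'\<close>-residual \<open>P\<close> is \<open>p\<close>-supersolvable
  because \<open>X / P\<close> is a \<open>p'\<close>-group with supersolvable quotient.  Conversely, if the quotient by \<open>R\<close> is \<open>p\<close>-supersolvable, there is \<open>M' \<ge> R\<close> with
  \<open>M' / R\<close> a \<open>p'\<close>-group and supersolvable quotient; then \<open>X \<le> M'\<close>, so every element of \<open>X\<close> of \<open>p\<close>-power
  order lies in \<open>R\<close>.\<close>

lemma (in group) p_supersolvable_residual: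
  assumes "finite (carrier G)" "solvable G" "prime p"
  shows "residual (p_supersolvable p) G = pprime_residual G p (residual supersolvable G)"
proof -
  define X where "X = residual supersolvable G"
  define P where "P = pprime_residual G p X"
  have X: "X \<lhd> G" "cyclic_series G X (carrier G)" "\<And>N. N \<lhd> G \<Longrightarrow> cyclic_series G N (carrier G) \<Longrightarrow> X \<subseteq> N"
    unfolding X_def using supersolvable_residual[OF assms(1)] by blast+
  interpret X: normal X G by (rule X(1))
  interpret P: normal P G unfolding P_def using X(1) by (rule pprime_residual_normal)
  have surj: "(\<lambda>x. R #> x) ` carrier G = carrier (G Mod R)" for R by (simp add: carrier_FactGroup)
  have fin: "finite (carrier (G Mod R))" for R using assms(1) by (simp add: carrier_FactGroup)
  have "p_supersolvable p (G Mod P)"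
  proof -
    interpret F: group "G Mod P" by (rule P.factorgroup_is_group)
    interpret \<pi>: group_hom G "G Mod P" "\<lambda>x. P #> x" by (rule P.group_hom_FactGroup)
    show ?thesis
    proof (rule F.p_supersolvableI[OF fin assms(3)])
      show "(\<lambda>x. P #> x) ` X \<lhd> G Mod P" using X.surj_hom_normal_subgroup \<pi>.group_hom_axioms surj by blast
      show "coprime_mod (G Mod P) p ((\<lambda>x. P #> x) ` X) {\<one>\<^bsub>G Mod P\<^esub>}"
        using \<pi>.coprime_mod_image[OF X.subset coprime_mod_pprime_residual[OF assms(1,3) X.subgroup_axioms]]
        unfolding P_def[symmetric] P.rcos_image_self .
      show "cyclic_series (G Mod P) ((\<lambda>x. P #> x) ` X) (carrier (G Mod P))"
        using \<pi>.cyclic_series_image[OF surj X(2,1)] unfolding surj .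
    qed
  qed
  moreover have "P \<subseteq> R" if R: "R \<lhd> G" "p_supersolvable p (G Mod R)" for R
  proof -
    interpret R: normal R G by (rule R(1))
    interpret F: group "G Mod R" by (rule R.factorgroup_is_group)
    interpret \<pi>: group_hom G "G Mod R" "\<lambda>x. R #> x" by (rule R.group_hom_FactGroup)
    have "solvable (G Mod R)" using \<pi>.surj_hom_imp_solvable surj assms(2) by blast
    then obtain M where M: "M \<lhd> G Mod R" "coprime_mod (G Mod R) p M {\<one>\<^bsub>G Mod R\<^esub>}"
      "cyclic_series (G Mod R) M (carrier (G Mod R))"
      using F.p_supersolvable_imp_series[OF fin _ assms(3) R(2) F.one_is_normal] by blast
    define M' where "M' = {x \<in> carrier G. R #> x \<in> M}"
    have "{x \<in> carrier G. R #> x \<in> carrier (G Mod R)} = carrier G" using surj by auto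
    then have "cyclic_series G M' (carrier G)"
      unfolding M'_def using \<pi>.cyclic_series_vimage[OF surj M(3,1)] by simp
    then have "X \<subseteq> M'" using X(3) \<pi>.normal_vimage[OF M(1)] unfolding M'_def by blast
    moreover have "coprime_mod G p M' R"
      unfolding M'_def using \<pi>.coprime_mod_vimage[OF M(2)] unfolding R.rcos_vimage_one .
    ultimately have "coprime_mod G p X R" unfolding coprime_mod_def by blast
    then show ?thesis
      unfolding P_def using pprime_residual_minimal X.subgroup_axioms R.subgroup_axioms by blast
  qed
  ultimately have "residual (p_supersolvable p) G = P"
    unfolding residual_def using P.normal_axioms P.subset by blast
  then show ?thesis unfolding P_def X_def .
qed

lemma (in group) solvable_subgroup_group:
  assumes "solvable G" "subgroup T G"
  shows "solvable (G\<lparr>carrier := T\<rparr>)"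
proof (rule group_hom.inj_hom_imp_solvable[OF _ _ assms(1)])
  show "group_hom (G\<lparr>carrier := T\<rparr>) G id"
    using assms(2) subgroup_imp_group is_group subgroup.mem_carrier
    by (auto simp: group_hom_def group_hom_axioms_def hom_def)
qed simp

lemma (in group) p_supersolvable_residual_subgroup:
  assumes "finite (carrier G)" "solvable G" "prime p" "subgroup T G"
  shows "residual (p_supersolvable p) (G\<lparr>carrier := T\<rparr>)
    = pprime_residual G p (residual supersolvable (G\<lparr>carrier := T\<rparr>))"
proof -
  interpret T: group "G\<lparr>carrier := T\<rparr>" using assms(4) by (rule subgroup_imp_group)
  define X where "X = residual supersolvable (G\<lparr>carrier := T\<rparr>)"
  have "X \<subseteq> T" unfolding X_def residual_def by simp
  have "residual (p_supersolvable p) (G\<lparr>carrier := T\<rparr>) = pprime_residual (G\<lparr>carrier := T\<rparr>) p X"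
    unfolding X_def using assms finite_subset[OF subgroup.subset] solvable_subgroup_group
    by (intro T.p_supersolvable_residual) auto
  also have "\<dots> = pprime_residual G p X"
    unfolding pprime_residual_def using \<open>X \<subseteq> T\<close> generate_consistent[OF _ assms(4)]
    by (subst generate_consistent) (auto simp: assms(4) simp flip: nat_pow_consistent)
  finally show ?thesis unfolding X_def .
qed

lemma (in group) normalizer_eq_carrier_iff:
  assumes "subgroup Z G"
  shows "normalizer G Z = carrier G \<longleftrightarrow> Z \<lhd> G"
proof -
  have sub: "Z \<subseteq> carrier G" using assms subgroup.subset by blast
  have "normalizer G Z = carrier G \<longleftrightarrow> (\<forall>g\<in>carrier G. g <# Z #> inv g = Z)"
    unfolding normalizer_def stabilizer_def using sub by auto
  also have "\<dots> \<longleftrightarrow> Z \<lhd> G"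
  proof
    assume inv: "\<forall>g\<in>carrier G. g <# Z #> inv g = Z"
    show "Z \<lhd> G"
    proof (rule normal_invI[OF assms])
      fix z g assume "z \<in> Z" "g \<in> carrier G"
      then have "g \<otimes> z \<otimes> inv g \<in> g <# Z #> inv g" by (auto simp: l_coset_def r_coset_def)
      then show "g \<otimes> z \<otimes> inv g \<in> Z" using inv \<open>g \<in> carrier G\<close> by simp
    qed
  next
    assume "Z \<lhd> G"
    then show "\<forall>g\<in>carrier G. g <# Z #> inv g = Z"
      using sub normal.coset_eq coset_mult_assoc by (metis coset_mult_one inv_closed r_inv)
  qed
  finally show ?thesis .
qed

text \<open>This turns both sides of the theorem into statements about normality of residuals.\<close>

lemma (in group) residual_normalizer_eq_carrier_iff:
  "residual_normalizer F G H = carrier G \<longleftrightarrow>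
    (\<forall>T. subgroup T G \<longrightarrow> T \<subseteq> H \<longrightarrow> residual F (G\<lparr>carrier := T\<rparr>) \<lhd> G)"
proof -
  have "residual_normalizer F G H = carrier G \<longleftrightarrow>
    (\<forall>T. subgroup T G \<longrightarrow> T \<subseteq> H \<longrightarrow> carrier G \<subseteq> normalizer G (residual F (G\<lparr>carrier := T\<rparr>)))"
    unfolding residual_normalizer_def by blast
  moreover have "normalizer G Z \<subseteq> carrier G" for Z unfolding normalizer_def stabilizer_def by blast
  moreover have "subgroup (residual F (G\<lparr>carrier := T\<rparr>)) G" if "subgroup T G" for T
    using that group.residual_subgroup[OF subgroup_imp_group] incl_subgroup by blast
  ultimately show ?thesis using normalizer_eq_carrier_iff by (metis subset_antisym subset_refl)
qed

theorem theorem3p13: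
  fixes G :: "('a, 'b) monoid_scheme" and H :: "'a set"
  assumes "group G"
    and "finite (carrier G)"
    and "solvable G"
    and "H \<lhd> G"
  shows "carrier G \<inter> (\<Inter>p\<in>prime_factors (card H). residual_normalizer (p_supersolvable p) G H)
           = carrier G
         \<longleftrightarrow> residual_normalizer supersolvable G H = carrier G"
proof -
  interpret group G by fact
  have H: "subgroup H G" using assms(4) by (rule normal_imp_subgroup)
  let ?X = "\<lambda>T. residual supersolvable (G\<lparr>carrier := T\<rparr>)"
  have eq: "residual (p_supersolvable p) (G\<lparr>carrier := T\<rparr>) = pprime_residual G p (?X T)"
    if "p \<in> prime_factors (card H)" "subgroup T G" for p T
    using p_supersolvable_residual_subgroup[OF assms(2,3) in_prime_factors_imp_prime] that .
  have "carrier G \<inter> (\<Inter>p\<in>prime_factors (card H). residual_normalizer (p_supersolvable p) G H) = carrier G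
      \<longleftrightarrow> (\<forall>p\<in>prime_factors (card H). carrier G \<subseteq> residual_normalizer (p_supersolvable p) G H)"
    by blast
  also have "\<dots> \<longleftrightarrow> (\<forall>p\<in>prime_factors (card H). residual_normalizer (p_supersolvable p) G H = carrier G)"
    unfolding residual_normalizer_def by blast
  also have "\<dots> \<longleftrightarrow> (\<forall>p\<in>prime_factors (card H). \<forall>T. subgroup T G \<longrightarrow> T \<subseteq> H \<longrightarrow>
      pprime_residual G p (?X T) \<lhd> G)"
    unfolding residual_normalizer_eq_carrier_iff using eq by simp
  also have "\<dots> \<longleftrightarrow> (\<forall>T. subgroup T G \<longrightarrow> T \<subseteq> H \<longrightarrow> ?X T \<lhd> G)"
  proof (intro iffI allI impI ballI)
    fix T assume norm: "\<forall>p\<in>prime_factors (card H). \<forall>T. subgroup T G \<longrightarrow> T \<subseteq> H \<longrightarrow> pprime_residual G p (?X T) \<lhd> G"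
      and T: "subgroup T G" "T \<subseteq> H"
    have "subgroup (?X T) G"
      using T group.residual_subgroup[OF subgroup_imp_group] incl_subgroup by blast
    moreover have "?X T \<subseteq> H" using T by (auto simp: residual_def)
    ultimately show "?X T \<lhd> G" using normal_if_pprime_residuals_normal[OF assms(2) H] norm T by blast
  qed (use pprime_residual_normal in blast)
  also have "\<dots> \<longleftrightarrow> residual_normalizer supersolvable G H = carrier G"
    by (simp add: residual_normalizer_eq_carrier_iff)
  finally show ?thesis .
qed

end
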